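(* Let $b=b(n)\ge 1$ be an integer-valued function that is subpolynomial in $n$. Then, as $n\to\infty$, $$\tau(\mathcal{PAN}_n,b)=\left(\frac12+o(1)\right)\log_{b+1}(n),$$ where $\mathcal{PAN}_n$ is the hypergraph with vertex set $E(K_n)$ whose hyperedges are the edge sets of all pancyclic spanning subgraphs of $K_n$.
   Context: A graph on $n$ vertices is pancyclic if it contains a cycle of every length $\ell$ with $3\le\ell\le n$. A function $f(n)$ is subpolynomial in $n$ if $f(n)=o(n^{\varepsilon})$ for all $\varepsilon>0$. Multistage $(1:b)$ Maker-Breaker game on a hypergraph $\mathcal{H}=(\mathcal{X},\mathcal{F})$ (board $\mathcal{X}$, family of winning sets $\mathcal{F}$), $b\ge 1$ an integer: Put $\mathcal{X}_0:=\mathcal{X}$, $\mathcal{F}_0:=\mathcal{F}$. For $i\ge 1$, in Stage $i$ Maker and Breaker play on the board $\mathcal{X}_{i-1}$, alternating in turns in which Maker claims exactly one unclaimed element of $\mathcal{X}_{i-1}$ and afterwards Breaker claims up to $b$ unclaimed elements of $\mathcal{X}_{i-1}$, with Maker moving first. Once all elements of $\mathcal{X}_{i-1}$ have been distributed among the players, $\mathcal{X}_i\subseteq\mathcal{X}_{i-1}$ denotes the set of all elements claimed by Maker in Stage $i$, and $\mathcal{F}_i:=\{F\in\mathcal{F}_{i-1}: F\subseteq\mathcal{X}_i\}$. The game stops the first time no winning sets are left. The threshold parameter $\tau(\mathcal{H},b)$ is the largest number $s$ such that Maker has a strategy (against every play of Breaker) ensuring $\mathcal{F}_s\neq\varnothing$.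 *)

theory Defs
  imports Complex_Main "HOL-Library.Landau_Symbols"
begin

section \<open>Multistage Maker-Breaker games\<close>

text \<open>
  A round \<open>(x, Y)\<close> consists of Maker's element \<open>x\<close> and the set \<open>Y\<close> that Breaker claims in reply;
  a stage is the list of its rounds in order, and a history is the list of the completed stages.
\<close>

type_synonym 'a round = "'a \<times> 'a set"
type_synonym 'a stage = "'a round list"
type_synonym 'a history = "'a stage list"

definition maker_claims :: "'a stage \<Rightarrow> 'a set" where
  "maker_claims rs = fst ` set rs"

definition breaker_claims :: "'a stage \<Rightarrow> 'a set" where
  "breaker_claims rs = \<Union> (snd ` set rs)"

definition unclaimed :: "'a set \<Rightarrow> 'a stage \<Rightarrow> 'a set" where
  "unclaimed X rs = X - (maker_claims rs \<union> breaker_claims rs)"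

text \<open>
  Legal, possibly unfinished stages on the board \<open>X\<close>. Breaker may claim fewer than \<open>b\<close> elements,
  even none; in particular Maker may take the last element of the board.
\<close>

inductive legal_stage :: "nat \<Rightarrow> 'a set \<Rightarrow> 'a stage \<Rightarrow> bool" for b :: nat and X :: "'a set" where
  start: "legal_stage b X []"
| round: "legal_stage b X (rs @ [(x, Y)])"
  if "legal_stage b X rs" "x \<in> unclaimed X rs"
     "Y \<subseteq> unclaimed X rs - {x}" "finite Y" "card Y \<le> b"

definition complete_stage :: "nat \<Rightarrow> 'a set \<Rightarrow> 'a stage \<Rightarrow> bool" where
  "complete_stage b X rs \<longleftrightarrow> legal_stage b X rs \<and> unclaimed X rs = {}"

text \<open>The board \<open>X\<^sub>i\<close> and the family \<open>F\<^sub>i\<close> after the \<open>i\<close> completed stages of a history.\<close>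

definition current_board :: "'a set \<Rightarrow> 'a history \<Rightarrow> 'a set" where
  "current_board X hs = (if hs = [] then X else maker_claims (last hs))"

definition current_family :: "'a set set \<Rightarrow> 'a history \<Rightarrow> 'a set set" where
  "current_family \<F> hs = foldl (\<lambda>\<G> rs. {F \<in> \<G>. F \<subseteq> maker_claims rs}) \<F> hs"

inductive legal_history :: "nat \<Rightarrow> 'a set \<Rightarrow> 'a history \<Rightarrow> bool" for b :: nat and X :: "'a set" where
  start: "legal_history b X []"
| stage: "legal_history b X (hs @ [rs])"
  if "legal_history b X hs" "complete_stage b (current_board X hs) rs"

text \<open>
  Maker's strategies may depend on the entire past: the completed stages and the rounds played so
  far in the current stage. A strategy has to give a legal move at every legal position.
\<close>

type_synonym 'a strategy = "'a history \<Rightarrow> 'a stage \<Rightarrow> 'a"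

definition maker_strategy :: "nat \<Rightarrow> 'a set \<Rightarrow> 'a strategy \<Rightarrow> bool" where
  "maker_strategy b X \<sigma> \<longleftrightarrow>
     (\<forall>hs rs. legal_history b X hs \<and> legal_stage b (current_board X hs) rs
        \<and> unclaimed (current_board X hs) rs \<noteq> {}
        \<longrightarrow> \<sigma> hs rs \<in> unclaimed (current_board X hs) rs)"

definition follows :: "'a strategy \<Rightarrow> 'a history \<Rightarrow> bool" where
  "follows \<sigma> hs \<longleftrightarrow>
     (\<forall>i < length hs. \<forall>j < length (hs ! i). fst (hs ! i ! j) = \<sigma> (take i hs) (take j (hs ! i)))"

text \<open>
  Play is continued formally after the family has become empty. As the families decrease, the one
  after \<open>s\<close> stages is nonempty iff the game has not stopped within the first \<open>s\<close> stages.
\<close>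

definition maker_ensures :: "'a set \<Rightarrow> 'a set set \<Rightarrow> nat \<Rightarrow> nat \<Rightarrow> bool" where
  "maker_ensures X \<F> b s \<longleftrightarrow>
     (\<exists>\<sigma>. maker_strategy b X \<sigma> \<and>
        (\<forall>hs. legal_history b X hs \<and> length hs = s \<and> follows \<sigma> hs
           \<longrightarrow> current_family \<F> hs \<noteq> {}))"

text \<open>
  The value is unspecified if no largest \<open>s\<close> exists, e.g. if the empty set is a winning set.
\<close>

definition threshold :: "'a set \<Rightarrow> 'a set set \<Rightarrow> nat \<Rightarrow> nat" where
  "threshold X \<F> b = (GREATEST s. maker_ensures X \<F> b s)"


section \<open>The pancyclicity hypergraph\<close>

text \<open>A graph is a vertex set \<open>V\<close> with a set \<open>E\<close> of two-element subsets of \<open>V\<close>.\<close>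

definition complete_edges :: "'v set \<Rightarrow> 'v set set" where
  "complete_edges V = {e. e \<subseteq> V \<and> card e = 2}"

text \<open>The list contains each vertex of the cycle once; the last vertex is joined to the first.\<close>

definition is_cycle :: "'v set \<Rightarrow> 'v set set \<Rightarrow> 'v list \<Rightarrow> bool" where
  "is_cycle V E vs \<longleftrightarrow> length vs \<ge> 3 \<and> distinct vs \<and> set vs \<subseteq> V \<and>
     (\<forall>i < length vs. {vs ! i, vs ! (Suc i mod length vs)} \<in> E)"

definition pancyclic :: "'v set \<Rightarrow> 'v set set \<Rightarrow> bool" where
  "pancyclic V E \<longleftrightarrow> (\<forall>l. 3 \<le> l \<and> l \<le> card V \<longrightarrow> (\<exists>vs. is_cycle V E vs \<and> length vs = l))"

definition PAN :: "nat \<Rightarrow> nat set set set" where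
  "PAN n = {E. E \<subseteq> complete_edges {..<n} \<and> pancyclic {..<n} E}"


section \<open>Subpolynomial functions\<close>

definition subpolynomial :: "(nat \<Rightarrow> real) \<Rightarrow> bool" where
  "subpolynomial f \<longleftrightarrow> (\<forall>\<epsilon>::real. \<epsilon> > 0 \<longrightarrow> f \<in> o(\<lambda>n. real n powr \<epsilon>))"

end

theory Submission
  imports Defs "HOL-Real_Asymp.Real_Asymp"
begin

text \<open>
  Breaker's bound. A cluster arises from a triangle by attaching triangles that share an edge with
  the previous ones. In density \<open>q = n powr (- 1 / 2 - \<epsilon>)\<close> each attached triangle costs a factor of about
  \<open>n * q\<^sup>2 + q\<close>, so clusters of \<open>m\<close> triangles have tiny expected number once \<open>m\<close> is a large constant, and a
  potential carried through all stages lets Breaker avoid them, although he loses a factor \<open>b + 1\<close>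
  per stage because Maker begins. Now the triangles fall into classes of bounded size. Pairing within the
  classes halves them in each further stage, and after boundedly many stages no triangle is left.

  Maker's bound. Using a potential with exponential weights, Maker retains in each stage a proportion
  of nearly \<open>1 / (b + 1)\<close> of each star and of each set of edges between two disjoint sets of \<open>k\<close> vertices,
  for \<open>k\<close> slightly smaller than \<open>sqrt n\<close>. At density \<open>n powr (- 1 / 2 + \<epsilon>)\<close> all degrees are still much larger
  than \<open>k\<close>, and any two disjoint \<open>k\<close>-sets are joined by an edge. By a rotation argument for longest paths, this
  makes all induced subgraphs of sufficient minimum degree Hamiltonian, which yields cycles of all lengths.
\<close>

section \<open>Stages and histories\<close>

text \<open>After \<open>s\<close> stages Maker's graph resembles a random graph of density
  \<open>q = 1 / (b + 1) ^ s\<close>, and \<open>1 / 2\<close> enters because the arguments of both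
  players change at \<open>n * q ^ 2 = 1\<close>. Maker wants \<open>k * q\<close> well above
  \<open>b * ln n\<close>, so that pairs of \<open>k\<close>-sets stay joined, and
  \<open>n * q\<close> well above \<open>k\<close>, for the degrees; these wishes are compatible
  only if \<open>q\<close> exceeds \<open>n powr (- 1 / 2)\<close>. Breaker faces the obstacle that
  a graph of this density still has about \<open>n powr (3 / 2)\<close> triangles, so counting
  triangles alone gives him nothing. What dies out just below this density is their overlap, because
  two adjacent vertices then rarely have common neighbours; and small disjoint groups of triangles
  can all be fought at once by pairing.

  Subpolynomiality of \<open>b\<close> makes \<open>log (b + 1) n\<close> exceed every constant. A
  bounded number of pairing stages and all roundings therefore disappear in the error term, and
  factors of \<open>b\<close> or \<open>b + 1\<close> are absorbed by small powers of
  \<open>n\<close>.\<close>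

lemma claims_Nil [simp]: "maker_claims [] = {}" "breaker_claims [] = {}"
  by (simp_all add: maker_claims_def breaker_claims_def)

lemma claims_snoc [simp]:
  "maker_claims (rs @ [(x, Y)]) = insert x (maker_claims rs)"
  "breaker_claims (rs @ [(x, Y)]) = breaker_claims rs \<union> Y"
  by (auto simp: maker_claims_def breaker_claims_def)

lemma legal_stage_claims:
  assumes "legal_stage b X rs"
  shows "maker_claims rs \<subseteq> X" "breaker_claims rs \<subseteq> X" "maker_claims rs \<inter> breaker_claims rs = {}"
proof -
  have "maker_claims rs \<subseteq> X \<and> breaker_claims rs \<subseteq> X \<and> maker_claims rs \<inter> breaker_claims rs = {}"
    using assms by induction (auto simp: unclaimed_def)
  then show "maker_claims rs \<subseteq> X" "breaker_claims rs \<subseteq> X" "maker_claims rs \<inter> breaker_claims rs = {}"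
    by auto
qed

lemma complete_stage_claims:
  assumes "complete_stage b X rs"
  shows "maker_claims rs \<subseteq> X" "breaker_claims rs = X - maker_claims rs"
  using assms legal_stage_claims[of b X rs] by (auto simp: complete_stage_def unclaimed_def)

lemma current_board_snoc [simp]: "current_board X (hs @ [rs]) = maker_claims rs"
  by (simp add: current_board_def)

lemma current_board_Nil [simp]: "current_board X [] = X"
  by (simp add: current_board_def)

lemma legal_history_board:
  "legal_history b X hs \<Longrightarrow> current_board X hs \<subseteq> X"
  by (induction rule: legal_history.induct) (use complete_stage_claims(1) in fastforce)+

text \<open>Boards only shrink, so the filters of all stages collapse to the last one, and it
  suffices to look at Maker's final graph.\<close>

lemma current_family_eq:
  assumes "legal_history b X hs" "\<And>F. F \<in> \<F> \<Longrightarrow> F \<subseteq> X"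
  shows "current_family \<F> hs = {F \<in> \<F>. F \<subseteq> current_board X hs}"
  using assms
proof (induction rule: legal_history.induct)
  case start
  then show ?case by (auto simp: current_family_def)
next
  case (stage hs rs)
  have "current_family \<F> (hs @ [rs]) = {F \<in> current_family \<F> hs. F \<subseteq> maker_claims rs}"
    by (simp add: current_family_def)
  then show ?case
    using stage complete_stage_claims(1)[OF stage.hyps(2)] by auto
qed

text \<open>Freezing the completed stages turns \<open>\<sigma>\<close> into the one-stage strategy
  \<open>\<sigma> hs\<close>; \<open>follows\<close> then splits into one condition per
  stage.\<close>

definition stage_follows :: "('a stage \<Rightarrow> 'a) \<Rightarrow> 'a stage \<Rightarrow> bool" where
  "stage_follows \<mu> rs \<longleftrightarrow> (\<forall>j < length rs. fst (rs ! j) = \<mu> (take j rs))"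

lemma stage_follows_Nil [simp]: "stage_follows \<mu> []"
  by (simp add: stage_follows_def)

lemma stage_follows_snoc [simp]:
  "stage_follows \<mu> (rs @ [r]) \<longleftrightarrow> stage_follows \<mu> rs \<and> fst r = \<mu> rs"
  by (auto simp: stage_follows_def nth_append less_Suc_eq)

lemma follows_Nil [simp]: "follows \<sigma> []"
  by (simp add: follows_def)

lemma follows_snoc [simp]:
  "follows \<sigma> (hs @ [rs]) \<longleftrightarrow> follows \<sigma> hs \<and> stage_follows (\<sigma> hs) rs"
  by (auto simp: follows_def stage_follows_def nth_append less_Suc_eq)

section \<open>Single stages from Breaker's side\<close>

definition stage_strategy :: "nat \<Rightarrow> 'a set \<Rightarrow> ('a stage \<Rightarrow> 'a) \<Rightarrow> bool" where
  "stage_strategy b X \<mu> \<longleftrightarrow>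
     (\<forall>rs. legal_stage b X rs \<and> unclaimed X rs \<noteq> {} \<longrightarrow> \<mu> rs \<in> unclaimed X rs)"

lemma maker_strategy_stage:
  assumes "maker_strategy b X \<sigma>" "legal_history b X hs"
  shows "stage_strategy b (current_board X hs) (\<sigma> hs)"
  using assms unfolding maker_strategy_def stage_strategy_def by blast

text \<open>\<open>reply\<close> copes with every unclaimed \<open>x\<close>, hence with the choice
  of \<open>\<mu>\<close>, so the invariant can be kept along a play that follows
  \<open>\<mu>\<close>. Each round uses up an element of a finite board; when none is left, Breaker
  owns the complement of Maker's set.\<close>

lemma breaker_stage:
  assumes "finite X"
    and \<mu>: "stage_strategy b X \<mu>"
    and init: "I {} {}"
    and reply: "\<And>M B x. M \<subseteq> X \<Longrightarrow> B \<subseteq> X \<Longrightarrow> M \<inter> B = {} \<Longrightarrow> x \<in> X - M - B \<Longrightarrow> I M B \<Longrightarrow>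
      \<exists>Y. Y \<subseteq> X - M - B - {x} \<and> card Y \<le> b \<and> I (insert x M) (B \<union> Y)"
  obtains rs where "complete_stage b X rs" "stage_follows \<mu> rs"
    "I (maker_claims rs) (X - maker_claims rs)"
proof -
  have "\<exists>rs'. complete_stage b X rs' \<and> stage_follows \<mu> rs' \<and> I (maker_claims rs') (breaker_claims rs')"
    if "legal_stage b X rs" "stage_follows \<mu> rs" "I (maker_claims rs) (breaker_claims rs)" for rs
    using that
  proof (induction "card (unclaimed X rs)" arbitrary: rs rule: less_induct)
    case less
    show ?case
    proof (cases "unclaimed X rs = {}")
      case True
      then show ?thesis using less.prems by (auto simp: complete_stage_def)
    next
      case False
      let ?x = "\<mu> rs"
      have x: "?x \<in> unclaimed X rs" using \<mu> less.prems(1) False by (auto simp: stage_strategy_def)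
      then have "?x \<in> X - maker_claims rs - breaker_claims rs" by (auto simp: unclaimed_def)
      from reply[OF legal_stage_claims[OF less.prems(1)] this less.prems(3)]
      obtain Y where Y: "Y \<subseteq> X - maker_claims rs - breaker_claims rs - {?x}" "card Y \<le> b"
        "I (insert ?x (maker_claims rs)) (breaker_claims rs \<union> Y)" by blast
      let ?rs = "rs @ [(?x, Y)]"
      have "Y \<subseteq> unclaimed X rs - {?x}" using Y(1) by (auto simp: unclaimed_def)
      moreover have "finite Y" using Y(1) \<open>finite X\<close> by (meson finite_Diff finite_subset)
      ultimately have legal: "legal_stage b X ?rs"
        using less.prems(1) x Y(2) by (intro legal_stage.round) auto
      have "unclaimed X ?rs \<subset> unclaimed X rs" using x by (auto simp: unclaimed_def)
      moreover have "finite (unclaimed X rs)" using \<open>finite X\<close> by (simp add: unclaimed_def)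
      ultimately have "card (unclaimed X ?rs) < card (unclaimed X rs)" by (rule psubset_card_mono[rotated])
      from less.hyps[OF this legal] show ?thesis using less.prems Y(3) by simp
    qed
  qed
  from this[OF legal_stage.start] init obtain rs where rs: "complete_stage b X rs" "stage_follows \<mu> rs"
    "I (maker_claims rs) (breaker_claims rs)" by auto
  then show thesis using that complete_stage_claims(2)[OF rs(1)] by simp
qed

text \<open>
  The potential of the biased Erdos-Selfridge criterion, for \<open>q = 1 / (b + 1)\<close>. Sets met by Breaker
  no longer count.
\<close>

definition potential :: "real \<Rightarrow> 'a set set \<Rightarrow> ('a set \<Rightarrow> real) \<Rightarrow> 'a set \<Rightarrow> 'a set \<Rightarrow> real" where
  "potential q \<F> w M B = (\<Sum>F | F \<in> \<F> \<and> F \<inter> B = {}. w F * q ^ card (F - M))"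

text \<open>The amount by which the potential drops if Breaker claims an unclaimed \<open>x\<close>.
  If Maker claims it, the potential grows by \<open>1 / q - 1\<close> times this amount, that is
  \<open>b\<close> times for \<open>q = 1 / (b + 1)\<close>.\<close>

definition potential_at :: "real \<Rightarrow> 'a set set \<Rightarrow> ('a set \<Rightarrow> real) \<Rightarrow> 'a set \<Rightarrow> 'a set \<Rightarrow> 'a \<Rightarrow> real" where
  "potential_at q \<F> w M B x = potential q {F \<in> \<F>. x \<in> F} w M B"

context
  fixes \<F> :: "'a set set" and w :: "'a set \<Rightarrow> real" and q :: real
  assumes fin: "finite \<F>" "\<forall>F\<in>\<F>. finite F"
    and pos: "\<forall>F\<in>\<F>. 0 \<le> w F" "0 < q"
begin

lemma potential_antimono:
  assumes "B \<subseteq> B'"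
  shows "potential q \<F> w M B' \<le> potential q \<F> w M B"
  unfolding potential_def using assms fin pos by (intro sum_mono2) auto

lemma potential_at_antimono:
  assumes "B \<subseteq> B'"
  shows "potential_at q \<F> w M B' x \<le> potential_at q \<F> w M B x"
  unfolding potential_at_def potential_def using assms fin pos by (intro sum_mono2) auto

lemma potential_at_le: "potential_at q \<F> w M B x \<le> potential q \<F> w M B"
  unfolding potential_at_def potential_def using fin pos by (intro sum_mono2) auto

lemma potential_insert_breaker:
  "potential q \<F> w M (insert y B) = potential q \<F> w M B - potential_at q \<F> w M B y"
proof -
  have "{F \<in> \<F>. F \<inter> B = {}} = {F \<in> \<F>. F \<inter> insert y B = {}} \<union> {F \<in> {F \<in> \<F>. y \<in> F}. F \<inter> B = {}}"
    by auto
  moreover have "{F \<in> \<F>. F \<inter> insert y B = {}} \<inter> {F \<in> {F \<in> \<F>. y \<in> F}. F \<inter> B = {}} = {}"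
    by auto
  ultimately show ?thesis
    unfolding potential_at_def potential_def using fin by (simp add: sum.union_disjoint)
qed

lemma potential_insert_maker:
  assumes "x \<notin> M" "x \<notin> B"
  shows "potential q \<F> w (insert x M) B = potential q \<F> w M B + (1 / q - 1) * potential_at q \<F> w M B x"
proof -
  have "w F * q ^ card (F - insert x M)
      = w F * q ^ card (F - M) + (1 / q - 1) * (if x \<in> F then w F * q ^ card (F - M) else 0)"
    if "F \<in> \<F>" for F
  proof (cases "x \<in> F")
    case True
    have "card (F - M) = Suc (card (F - M - {x}))"
      using True assms fin(2) that by (intro card.remove) auto
    moreover have "F - M - {x} = F - insert x M" by auto
    ultimately show ?thesis using True pos(2) by (simp add: field_simps)
  next
    case False
    then have "F - insert x M = F - M" by auto
    then show ?thesis using False by simp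
  qed
  then have "potential q \<F> w (insert x M) B = (\<Sum>F | F \<in> \<F> \<and> F \<inter> B = {}.
      w F * q ^ card (F - M) + (1 / q - 1) * (if x \<in> F then w F * q ^ card (F - M) else 0))"
    unfolding potential_def by (intro sum.cong) auto
  also have "\<dots> = potential q \<F> w M B
      + (1 / q - 1) * (\<Sum>F | F \<in> \<F> \<and> F \<inter> B = {}. if x \<in> F then w F * q ^ card (F - M) else 0)"
    unfolding potential_def by (simp add: sum.distrib sum_distrib_left)
  also have "(\<Sum>F | F \<in> \<F> \<and> F \<inter> B = {}. if x \<in> F then w F * q ^ card (F - M) else 0)
      = potential_at q \<F> w M B x"
    unfolding potential_at_def potential_def using fin
    by (subst sum.inter_filter[symmetric]) (auto intro!: sum.cong)
  finally show ?thesis .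
qed

text \<open>
  Claiming the \<open>j\<close> most dangerous elements one after the other compensates the gain from Maker's
  next element \<open>z\<close>.
\<close>

lemma potential_greedy:
  assumes "finite U" "j \<le> card U"
  shows "\<exists>Y \<subseteq> U. card Y = j \<and> (\<forall>z \<in> U - Y.
    potential q \<F> w M (B \<union> Y) + real j * potential_at q \<F> w M (B \<union> Y) z \<le> potential q \<F> w M B)"
  using assms(2)
proof (induction j)
  case 0
  then show ?case by (intro exI[of _ "{}"]) auto
next
  case (Suc j)
  then obtain Y where Y: "Y \<subseteq> U" "card Y = j" and le: "\<And>z. z \<in> U - Y \<Longrightarrow>
    potential q \<F> w M (B \<union> Y) + real j * potential_at q \<F> w M (B \<union> Y) z \<le> potential q \<F> w M B"
    by auto
  have finY: "finite Y" using Y(1) assms(1) finite_subset by blast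
  let ?f = "potential_at q \<F> w M (B \<union> Y)"
  have ne: "U - Y \<noteq> {}" using Suc.prems Y finY
    by (metis Diff_eq_empty_iff card_mono not_less_eq_eq)
  have fi: "finite (?f ` (U - Y))" using assms(1) by simp
  from Max_in[OF fi] ne obtain y where y: "y \<in> U - Y" "?f y = Max (?f ` (U - Y))" by fastforce
  have ymax: "?f z \<le> ?f y" if "z \<in> U - Y" for z using y(2) fi that by simp
  have "potential q \<F> w M (B \<union> insert y Y) + real (Suc j) * potential_at q \<F> w M (B \<union> insert y Y) z
      \<le> potential q \<F> w M B" if z: "z \<in> U - insert y Y" for z
  proof -
    let ?g = "potential_at q \<F> w M (B \<union> insert y Y) z"
    have "?g \<le> ?f z" by (rule potential_at_antimono) auto
    moreover have "?f z \<le> ?f y" using ymax z by auto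
    moreover have "real j * ?g \<le> real j * ?f z" using calculation by (intro mult_left_mono) auto
    moreover have "potential q \<F> w M (B \<union> insert y Y) = potential q \<F> w M (B \<union> Y) - ?f y"
      using potential_insert_breaker[of M y "B \<union> Y"] by simp
    ultimately show ?thesis using le[of z] z by (simp add: algebra_simps)
  qed
  then show ?case using y finY Y by (intro exI[of _ "insert y Y"]) auto
qed

end

text \<open>The factor \<open>1 + real b\<close> is paid once, for Maker's opening element, which
  may add up to \<open>b\<close> times the whole potential. From then on Breaker's greedy claims pay
  in advance for whatever Maker takes next. In the final position a surviving set has no element
  outside Maker's set, so it counts with its full weight \<open>w F\<close>.\<close>

lemma breaker_stage_potential:
  fixes w :: "'a set \<Rightarrow> real"
  assumes "finite X"
    and \<mu>: "stage_strategy b X \<mu>"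
    and \<F>: "finite \<F>" "\<forall>F\<in>\<F>. finite F" "\<forall>F\<in>\<F>. 0 \<le> w F"
  obtains rs where "complete_stage b X rs" "stage_follows \<mu> rs"
    "(\<Sum>F | F \<in> \<F> \<and> F \<subseteq> maker_claims rs. w F)
       \<le> (1 + real b) * (\<Sum>F | F \<in> \<F> \<and> F \<subseteq> X. w F / (1 + real b) ^ card F)"
proof -
  define \<G> where "\<G> = {F \<in> \<F>. F \<subseteq> X}"
  define q where "q = 1 / (1 + real b)"
  have q: "0 < q" "1 / q = 1 + real b" by (auto simp: q_def)
  have G: "finite \<G>" "\<forall>F\<in>\<G>. finite F" "\<forall>F\<in>\<G>. 0 \<le> w F"
    using \<F> by (auto simp: \<G>_def)
  note P = G(1) G(2) G(3) q(1)
  let ?P = "potential q \<G> w"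
  define C where "C = (1 + real b) * ?P {} {}"
  have C0: "?P {} {} \<le> C"
  proof -
    have "0 \<le> real b * ?P {} {}"
      unfolding potential_def using G(3) q(1) by (intro mult_nonneg_nonneg sum_nonneg) auto
    then show ?thesis by (simp add: C_def algebra_simps)
  qed
  \<comment> \<open>The second conjunct looks one move of Maker ahead; it is the part that Breaker's
    reply has to restore.\<close>
  define I where "I M B \<longleftrightarrow> ?P M B \<le> C \<and> (\<forall>x \<in> X - M - B. ?P (insert x M) B \<le> C)" for M B
  have "I {} {}"
  proof -
    have "?P {x} {} \<le> C" for x
    proof -
      have "?P {x} {} = ?P {} {} + real b * potential_at q \<G> w {} {} x"
        using potential_insert_maker[OF P, where x = x and M = "{}" and B = "{}"] q(2) by simp
      also have "\<dots> \<le> ?P {} {} + real b * ?P {} {}"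
        using potential_at_le[OF P] by (intro add_left_mono mult_left_mono) auto
      finally show ?thesis by (simp add: C_def algebra_simps)
    qed
    then show ?thesis using C0 by (simp add: I_def)
  qed
  moreover have "\<exists>Y. Y \<subseteq> X - M - B - {x} \<and> card Y \<le> b \<and> I (insert x M) (B \<union> Y)"
    if "x \<in> X - M - B" "I M B" for M B x
  proof -
    let ?U = "X - M - B - {x}" and ?M = "insert x M"
    have fU: "finite ?U" using \<open>finite X\<close> by simp
    have le: "?P ?M B \<le> C" using that by (simp add: I_def)
    have le': "?P ?M (B \<union> Y) \<le> C" for Y
      using potential_antimono[OF P, where B = B and B' = "B \<union> Y" and M = ?M] le by simp
    show ?thesis
    proof (cases "b \<le> card ?U")
      \<comment> \<open>Fewer than \<open>b\<close> elements are left: Breaker takes them all, and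
        no move of Maker remains to be bounded.\<close>
      case False
      have "X - ?M - (B \<union> ?U) = {}" by auto
      then have "I ?M (B \<union> ?U)" unfolding I_def using le' by blast
      then show ?thesis using False by (intro exI[of _ ?U]) auto
    next
      case True
      from potential_greedy[OF P fU this, where M = ?M and B = B]
      obtain Y where Y: "Y \<subseteq> ?U" "card Y = b" "\<And>z. z \<in> ?U - Y \<Longrightarrow>
        ?P ?M (B \<union> Y) + real b * potential_at q \<G> w ?M (B \<union> Y) z \<le> ?P ?M B" by auto
      have "?P (insert z ?M) (B \<union> Y) \<le> C" if z: "z \<in> X - ?M - (B \<union> Y)" for z
        using Y(3)[of z] potential_insert_maker[OF P, where x = z and M = ?M and B = "B \<union> Y"] q(2) le z by auto
      then have "I ?M (B \<union> Y)" using le' by (auto simp: I_def)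
      then show ?thesis using Y by blast
    qed
  qed
  ultimately obtain rs where rs: "complete_stage b X rs" "stage_follows \<mu> rs"
    "I (maker_claims rs) (X - maker_claims rs)"
    using breaker_stage[OF \<open>finite X\<close> \<mu>, where I = I] by metis
  let ?M = "maker_claims rs"
  have M: "?M \<subseteq> X" using complete_stage_claims(1)[OF rs(1)] .
  have "(\<Sum>F | F \<in> \<F> \<and> F \<subseteq> ?M. w F) = ?P ?M (X - ?M)"
    unfolding potential_def
  proof (rule sum.cong)
    show "{F \<in> \<F>. F \<subseteq> ?M} = {F \<in> \<G>. F \<inter> (X - ?M) = {}}" using M by (auto simp: \<G>_def)
    fix F assume "F \<in> {F \<in> \<G>. F \<inter> (X - ?M) = {}}"
    then have "F - ?M = {}" by (auto simp: \<G>_def)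
    then show "w F = w F * q ^ card (F - ?M)" by (simp only: card.empty power_0 mult_1_right)
  qed
  also have "\<dots> \<le> C" using rs(3) by (simp add: I_def)
  also have "?P {} {} = (\<Sum>F | F \<in> \<F> \<and> F \<subseteq> X. w F / (1 + real b) ^ card F)"
    unfolding potential_def \<G>_def q_def by (intro sum.cong) (auto simp: power_one_over field_simps)
  then have "C = (1 + real b) * (\<Sum>F | F \<in> \<F> \<and> F \<subseteq> X. w F / (1 + real b) ^ card F)"
    by (simp add: C_def)
  finally show thesis using that rs by blast
qed

text \<open>Breaker answers inside the class of Maker's element. He fails only if Maker has just
  taken the last free element of that class, so in no class does Maker end more than one element
  ahead.\<close>

lemma breaker_stage_pairing:
  fixes \<pi> :: "'a \<Rightarrow> 'c"
  assumes "finite X" "b \<ge> 1"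
    and \<mu>: "stage_strategy b X \<mu>"
  obtains rs where "complete_stage b X rs" "stage_follows \<mu> rs"
    "\<forall>c. 2 * card {y \<in> maker_claims rs. \<pi> y = c} \<le> card {y \<in> X. \<pi> y = c} + 1"
proof -
  \<comment> \<open>The second alternative describes an exhausted class, in which Maker took the
    unpaired last element.\<close>
  define I where "I M B \<longleftrightarrow> (\<forall>c. card {y \<in> M. \<pi> y = c} \<le> card {y \<in> B. \<pi> y = c} \<or>
      (\<forall>y \<in> X - M - B. \<pi> y \<noteq> c) \<and> card {y \<in> M. \<pi> y = c} \<le> card {y \<in> B. \<pi> y = c} + 1)" for M B
  have "I {} {}" by (simp add: I_def)
  moreover have "\<exists>Y. Y \<subseteq> X - M - B - {x} \<and> card Y \<le> b \<and> I (insert x M) (B \<union> Y)"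
    if MB: "M \<subseteq> X" "B \<subseteq> X" and x: "x \<in> X - M - B" and I: "I M B" for M B x
  proof -
    have fin: "finite M" "finite B" using MB \<open>finite X\<close> finite_subset by auto
    have M': "{y \<in> insert x M. \<pi> y = c} = (if \<pi> x = c then insert x {y \<in> M. \<pi> y = c} else {y \<in> M. \<pi> y = c})" for c
      by auto
    have cM: "card {y \<in> insert x M. \<pi> y = c} = card {y \<in> M. \<pi> y = c} + (if \<pi> x = c then 1 else 0)" for c
      unfolding M' using fin x by auto
    have Ix: "card {y \<in> M. \<pi> y = \<pi> x} \<le> card {y \<in> B. \<pi> y = \<pi> x}"
      using I x unfolding I_def by blast
    show ?thesis
    proof (cases "\<exists>z \<in> X - M - B - {x}. \<pi> z = \<pi> x")
      case True
      then obtain z where z: "z \<in> X - M - B - {x}" "\<pi> z = \<pi> x" by blast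
      have B': "{y \<in> B \<union> {z}. \<pi> y = c} = (if \<pi> x = c then insert z {y \<in> B. \<pi> y = c} else {y \<in> B. \<pi> y = c})" for c
        using z by auto
      have cB: "card {y \<in> B \<union> {z}. \<pi> y = c} = card {y \<in> B. \<pi> y = c} + (if \<pi> x = c then 1 else 0)" for c
        unfolding B' using fin z by auto
      have "I (insert x M) (B \<union> {z})"
        unfolding I_def cM cB using I unfolding I_def by auto
      then show ?thesis using z assms(2) by (intro exI[of _ "{z}"]) auto
    next
      case False
      have "card {y \<in> insert x M. \<pi> y = c} \<le> card {y \<in> B. \<pi> y = c} \<or>
        (\<forall>y \<in> X - insert x M - B. \<pi> y \<noteq> c) \<and> card {y \<in> insert x M. \<pi> y = c} \<le> card {y \<in> B. \<pi> y = c} + 1" for c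
      proof (cases "\<pi> x = c")
        case True
        then show ?thesis using False Ix unfolding cM by auto
      next
        case ne: False
        then show ?thesis using I unfolding cM I_def by auto
      qed
      then have "I (insert x M) (B \<union> {})" unfolding I_def by simp
      then show ?thesis by (intro exI[of _ "{}"]) auto
    qed
  qed
  ultimately obtain rs where rs: "complete_stage b X rs" "stage_follows \<mu> rs"
    "I (maker_claims rs) (X - maker_claims rs)"
    using breaker_stage[OF \<open>finite X\<close> \<mu>, where I = I] by metis
  let ?M = "maker_claims rs"
  have M: "?M \<subseteq> X" using complete_stage_claims(1)[OF rs(1)] .
  have "2 * card {y \<in> ?M. \<pi> y = c} \<le> card {y \<in> X. \<pi> y = c} + 1" for c
  proof -
    have "{y \<in> X. \<pi> y = c} = {y \<in> ?M. \<pi> y = c} \<union> {y \<in> X - ?M. \<pi> y = c}" using M by auto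
    then have "card {y \<in> X. \<pi> y = c} = card {y \<in> ?M. \<pi> y = c} + card {y \<in> X - ?M. \<pi> y = c}"
      using \<open>finite X\<close> finite_subset[OF M] by (auto intro!: card_Un_disjoint)
    moreover have "card {y \<in> ?M. \<pi> y = c} \<le> card {y \<in> X - ?M. \<pi> y = c} + 1"
      using spec[OF rs(3)[unfolded I_def], of c] by linarith
    ultimately show ?thesis by simp
  qed
  then show thesis using that rs by blast
qed

text \<open>The weights \<open>1 / (1 + real b) ^ ((s - i) * card F)\<close> discount a set for the
  stages still to come, and stage \<open>i + 1\<close> uses up exactly one of the
  \<open>s - i\<close> discounts. Each stage also costs one factor \<open>1 + real b\<close>, which
  explains the power in \<open>small\<close>. After \<open>s\<close> stages all weights are 1, so
  the sum counts the surviving sets; being less than 1, it is 0.\<close>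

lemma breaker_potential:
  assumes "finite X" and \<sigma>: "maker_strategy b X \<sigma>"
    and \<F>: "finite \<F>" "\<And>F. F \<in> \<F> \<Longrightarrow> F \<subseteq> X"
    and small: "(1 + real b) ^ s * (\<Sum>F \<in> \<F>. 1 / (1 + real b) ^ (s * card F)) < 1"
  obtains hs where "legal_history b X hs" "follows \<sigma> hs" "length hs = s"
    "\<And>F. F \<in> \<F> \<Longrightarrow> \<not> F \<subseteq> current_board X hs"
proof -
  let ?S = "\<lambda>i Y. \<Sum>F | F \<in> \<F> \<and> F \<subseteq> Y. 1 / (1 + real b) ^ ((s - i) * card F)"
  have finF: "\<forall>F\<in>\<F>. finite F" using \<F>(2) \<open>finite X\<close> finite_subset by blast
  have "\<exists>hs. legal_history b X hs \<and> follows \<sigma> hs \<and> length hs = i \<and>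
      ?S i (current_board X hs) \<le> (1 + real b) ^ i * ?S 0 X" if "i \<le> s" for i
    using that
  proof (induction i)
    case 0
    show ?case by (intro exI[of _ "[]"]) (auto intro: legal_history.start)
  next
    case (Suc i)
    then obtain hs where hs: "legal_history b X hs" "follows \<sigma> hs" "length hs = i"
      "?S i (current_board X hs) \<le> (1 + real b) ^ i * ?S 0 X" by auto
    let ?Y = "current_board X hs"
    have finY: "finite ?Y" using legal_history_board[OF hs(1)] \<open>finite X\<close> finite_subset by blast
    obtain rs where rs: "complete_stage b ?Y rs" "stage_follows (\<sigma> hs) rs"
      "?S (Suc i) (maker_claims rs) \<le> (1 + real b) *
        (\<Sum>F | F \<in> \<F> \<and> F \<subseteq> ?Y. 1 / (1 + real b) ^ ((s - Suc i) * card F) / (1 + real b) ^ card F)"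
      using breaker_stage_potential[OF finY maker_strategy_stage[OF \<sigma> hs(1)] \<F>(1) finF,
          where w = "\<lambda>F. 1 / (1 + real b) ^ ((s - Suc i) * card F)"]
      by auto
    have "s - i = Suc (s - Suc i)" using Suc.prems by simp
    then have "1 / (1 + real b) ^ ((s - Suc i) * card F) / (1 + real b) ^ card F
        = 1 / (1 + real b) ^ ((s - i) * card F)" for F :: "'a set"
      by (simp add: power_add mult.commute)
    with rs(3) have "?S (Suc i) (maker_claims rs) \<le> (1 + real b) * ?S i ?Y" by simp
    also have "\<dots> \<le> (1 + real b) * ((1 + real b) ^ i * ?S 0 X)"
      using hs(4) by (intro mult_left_mono) auto
    finally have "?S (Suc i) (maker_claims rs) \<le> (1 + real b) ^ Suc i * ?S 0 X" by (simp add: mult.assoc)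
    then show ?case using hs rs
      by (intro exI[of _ "hs @ [rs]"]) (auto intro: legal_history.stage)
  qed
  then obtain hs where hs: "legal_history b X hs" "follows \<sigma> hs" "length hs = s"
    "?S s (current_board X hs) \<le> (1 + real b) ^ s * ?S 0 X" by blast
  have "?S 0 X = (\<Sum>F \<in> \<F>. 1 / (1 + real b) ^ (s * card F))"
    using \<F>(2) by (intro sum.cong) auto
  with hs(4) small have "real (card {F \<in> \<F>. F \<subseteq> current_board X hs}) < 1" by simp
  then have "{F \<in> \<F>. F \<subseteq> current_board X hs} = {}" using \<F>(1) by (simp add: card_eq_0_iff)
  then show thesis using that hs by blast
qed

text \<open>The bound \<open>2 ^ t + 1\<close> fits the recursion: halving
  \<open>2 ^ Suc t + 1\<close> with the rounding of one pairing stage gives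
  \<open>2 ^ t + 1\<close>. It ends at 2, one less than the number of edges of a triangle.\<close>

lemma breaker_pairing:
  fixes \<pi> :: "'a \<Rightarrow> 'c"
  assumes "finite X" "b \<ge> 1" and \<sigma>: "maker_strategy b X \<sigma>"
    and "legal_history b X hs" "follows \<sigma> hs"
    and "\<And>c. card {y \<in> current_board X hs. \<pi> y = c} \<le> 2 ^ t + 1"
  obtains hs' where "legal_history b X hs'" "follows \<sigma> hs'" "length hs' = length hs + t"
    "current_board X hs' \<subseteq> current_board X hs"
    "\<forall>c. card {y \<in> current_board X hs'. \<pi> y = c} \<le> 2"
proof -
  have "\<exists>hs'. legal_history b X hs' \<and> follows \<sigma> hs' \<and> length hs' = length hs + t \<and>
    current_board X hs' \<subseteq> current_board X hs \<and>
    (\<forall>c. card {y \<in> current_board X hs'. \<pi> y = c} \<le> 2)"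
    using assms(4-6)
  proof (induction t arbitrary: hs)
    case 0
    then show ?case by (intro exI[of _ hs]) (auto simp: numeral_2_eq_2)
  next
    case (Suc t)
    let ?Y = "current_board X hs"
    have finY: "finite ?Y" using legal_history_board[OF Suc.prems(1)] \<open>finite X\<close> finite_subset by blast
    obtain rs where rs: "complete_stage b ?Y rs" "stage_follows (\<sigma> hs) rs"
      "\<forall>c. 2 * card {y \<in> maker_claims rs. \<pi> y = c} \<le> card {y \<in> ?Y. \<pi> y = c} + 1"
      by (rule breaker_stage_pairing[OF finY assms(2) maker_strategy_stage[OF \<sigma> Suc.prems(1)], where \<pi> = \<pi>])
    have "card {y \<in> maker_claims rs. \<pi> y = c} \<le> 2 ^ t + 1" for c
      using spec[OF rs(3), of c] Suc.prems(3)[of c] by simp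
    then obtain hs' where hs': "legal_history b X hs'" "follows \<sigma> hs'" "length hs' = length (hs @ [rs]) + t"
      "current_board X hs' \<subseteq> maker_claims rs"
      "\<And>c. card {y \<in> current_board X hs'. \<pi> y = c} \<le> 2"
      using Suc.IH[of "hs @ [rs]"] Suc.prems rs by (auto intro: legal_history.stage)
    then show ?case using complete_stage_claims(1)[OF rs(1)] by (intro exI[of _ hs']) auto
  qed
  then show thesis using that by blast
qed

section \<open>Maker keeps a proportion of large sets\<close>

text \<open>
  The parameters are used with \<open>(1 + a) ^ b = 1 + \<eta>\<close>: up to \<open>b\<close> elements of Breaker raise the danger of a set by a
  factor of at most \<open>1 + \<eta>\<close>, an element of Maker lowers it by the factor \<open>1 - \<eta>\<close>.
\<close>

definition danger :: "real \<Rightarrow> real \<Rightarrow> 'a set set \<Rightarrow> 'a set \<Rightarrow> 'a set \<Rightarrow> real" where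
  "danger a \<eta> \<A> M B = (\<Sum>A\<in>\<A>. (1 + a) ^ card (A \<inter> B) * (1 - \<eta>) ^ card (A \<inter> M))"

definition danger_at :: "real \<Rightarrow> real \<Rightarrow> 'a set set \<Rightarrow> 'a set \<Rightarrow> 'a set \<Rightarrow> 'a \<Rightarrow> real" where
  "danger_at a \<eta> \<A> M B x = danger a \<eta> {A \<in> \<A>. x \<in> A} M B"

text \<open>Claiming an unclaimed \<open>x\<close> multiplies the danger of every set through
  \<open>x\<close> by \<open>1 - \<eta>\<close>, so the largest \<open>danger_at\<close> gives the
  largest drop.\<close>

definition greedy :: "real \<Rightarrow> real \<Rightarrow> 'a set set \<Rightarrow> 'a set \<Rightarrow> 'a stage \<Rightarrow> 'a" where
  "greedy a \<eta> \<A> X rs =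
     (SOME x. x \<in> unclaimed X rs \<and> (\<forall>y \<in> unclaimed X rs.
        danger_at a \<eta> \<A> (maker_claims rs) (breaker_claims rs) y
          \<le> danger_at a \<eta> \<A> (maker_claims rs) (breaker_claims rs) x))"

lemma greedy:
  assumes "finite X" "unclaimed X rs \<noteq> {}"
  shows "greedy a \<eta> \<A> X rs \<in> unclaimed X rs"
    and "y \<in> unclaimed X rs \<Longrightarrow> danger_at a \<eta> \<A> (maker_claims rs) (breaker_claims rs) y
          \<le> danger_at a \<eta> \<A> (maker_claims rs) (breaker_claims rs) (greedy a \<eta> \<A> X rs)"
proof -
  let ?U = "unclaimed X rs"
  let ?f = "danger_at a \<eta> \<A> (maker_claims rs) (breaker_claims rs)"
  have fin: "finite (?f ` ?U)" using assms(1) by (simp add: unclaimed_def)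
  from Max_in[OF fin] assms(2) obtain x where x: "x \<in> ?U" "?f x = Max (?f ` ?U)" by fastforce
  then have "x \<in> ?U \<and> (\<forall>y \<in> ?U. ?f y \<le> ?f x)" using fin by simp
  then have "greedy a \<eta> \<A> X rs \<in> ?U \<and> (\<forall>y \<in> ?U. ?f y \<le> ?f (greedy a \<eta> \<A> X rs))"
    unfolding greedy_def by (rule someI)
  then show "greedy a \<eta> \<A> X rs \<in> ?U" "y \<in> ?U \<Longrightarrow> ?f y \<le> ?f (greedy a \<eta> \<A> X rs)" by auto
qed

text \<open>The increments \<open>a * (1 + a) ^ i\<close> grow with \<open>i\<close>, so the average
  of the first \<open>k\<close> is at most that of the first \<open>b\<close>. For
  \<open>(1 + a) ^ b = 1 + \<eta>\<close> this bounds the effect of \<open>k\<close> elements of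
  Breaker linearly, by \<open>1 + \<eta> * k / b\<close>.\<close>

lemma power_minus_one_convex:
  fixes a :: real
  assumes "0 \<le> a" "k \<le> b"
  shows "real b * ((1 + a) ^ k - 1) \<le> real k * ((1 + a) ^ b - 1)"
  using assms(2)
proof (induction b rule: dec_induct)
  case base
  then show ?case by simp
next
  case (step n)
  have "(1 + a) ^ k - 1 \<le> real k * (a * (1 + a) ^ n)" if "k \<le> n" for k
    using that
  proof (induction k)
    case (Suc k)
    have "a * (1 + a) ^ k \<le> a * (1 + a) ^ n"
      using Suc.prems assms(1) by (intro mult_left_mono power_increasing) auto
    then show ?case using Suc by (simp add: algebra_simps)
  qed simp
  from this[OF step.hyps(1)] step.IH show ?case by (simp add: algebra_simps)
qed

text \<open>Once the factor of each set is linearised, Breaker adds at most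
  \<open>\<eta> / b\<close> times the sum of \<open>danger_at\<close> over \<open>Y\<close>, while
  Maker removes \<open>\<eta>\<close> times the value at \<open>x\<close>. Both are measured before
  the round, when the elements of \<open>Y\<close> were also available to Maker; as there are at
  most \<open>b\<close> of them, none more dangerous than \<open>x\<close>, the balance is not
  positive.\<close>

lemma danger_round:
  assumes "finite \<A>" "b \<ge> 1" "0 \<le> a" "(1 + a) ^ b = 1 + \<eta>" "\<eta> \<le> 1"
    and "finite M" "finite B" "x \<notin> M" "finite Y" "card Y \<le> b" "Y \<inter> B = {}"
    and max: "\<And>y. y \<in> Y \<Longrightarrow> danger_at a \<eta> \<A> M B y \<le> danger_at a \<eta> \<A> M B x"
  shows "danger a \<eta> \<A> (insert x M) (B \<union> Y) \<le> danger a \<eta> \<A> M B"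
proof -
  have "0 \<le> \<eta>" using one_le_power[of "1 + a" b] assms(3,4) by simp
  define \<phi> where "\<phi> A = (1 + a) ^ card (A \<inter> B) * (1 - \<eta>) ^ card (A \<inter> M)" for A
  have \<phi>: "0 \<le> \<phi> A" for A using assms(3,5) by (simp add: \<phi>_def)
  have at: "danger_at a \<eta> \<A> M B y = (\<Sum>A\<in>\<A>. if y \<in> A then \<phi> A else 0)" for y
    unfolding danger_at_def danger_def \<phi>_def using assms(1) by (simp add: sum.inter_filter)
  have "(1 + a) ^ card (A \<inter> (B \<union> Y)) * (1 - \<eta>) ^ card (A \<inter> insert x M)
      \<le> \<phi> A + \<eta> / b * (\<Sum>y\<in>Y. if y \<in> A then \<phi> A else 0) - \<eta> * (if x \<in> A then \<phi> A else 0)" for A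
  proof -
    let ?k = "card (A \<inter> Y)" and ?e = "if x \<in> A then 1 else (0 :: real)"
    have k: "?k \<le> b" using assms(9,10) card_mono[of Y "A \<inter> Y"] by auto
    have "card (A \<inter> (B \<union> Y)) = card (A \<inter> B) + ?k"
      unfolding Int_Un_distrib using assms(7,9,11) by (intro card_Un_disjoint) auto
    moreover have "(1 - \<eta>) ^ card (A \<inter> insert x M) = (1 - \<eta>) ^ card (A \<inter> M) * (1 - \<eta> * ?e)"
      using assms(6,8) by (cases "x \<in> A") auto
    ultimately have "(1 + a) ^ card (A \<inter> (B \<union> Y)) * (1 - \<eta>) ^ card (A \<inter> insert x M)
        = \<phi> A * ((1 + a) ^ ?k * (1 - \<eta> * ?e))"
      by (simp add: \<phi>_def power_add)
    also have "\<dots> \<le> \<phi> A * ((1 + \<eta> / b * ?k) * (1 - \<eta> * ?e))"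
    proof (intro mult_left_mono mult_right_mono \<phi>)
      have "real b * ((1 + a) ^ ?k - 1) \<le> real ?k * \<eta>"
        using power_minus_one_convex[OF assms(3) k] assms(4) by simp
      then show "(1 + a) ^ ?k \<le> 1 + \<eta> / b * ?k" using assms(2) by (simp add: field_simps)
      show "0 \<le> 1 - \<eta> * ?e" using assms(5) by simp
    qed
    also have "\<dots> \<le> \<phi> A * (1 + \<eta> / b * ?k - \<eta> * ?e)"
    proof (intro mult_left_mono \<phi>)
      have "0 \<le> \<eta> / b * ?k * (\<eta> * ?e)" using \<open>0 \<le> \<eta>\<close> by simp
      then show "(1 + \<eta> / b * ?k) * (1 - \<eta> * ?e) \<le> 1 + \<eta> / b * ?k - \<eta> * ?e"
        by (simp only: algebra_simps)
    qed
    also have "(\<Sum>y\<in>Y. if y \<in> A then \<phi> A else 0) = ?k * \<phi> A"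
      using assms(9) by (simp add: sum.inter_restrict[symmetric] Int_commute)
    then have "\<phi> A * (1 + \<eta> / b * ?k - \<eta> * ?e)
      = \<phi> A + \<eta> / b * (\<Sum>y\<in>Y. if y \<in> A then \<phi> A else 0) - \<eta> * (if x \<in> A then \<phi> A else 0)"
      by (simp add: algebra_simps)
    finally show ?thesis .
  qed
  then have "danger a \<eta> \<A> (insert x M) (B \<union> Y)
      \<le> (\<Sum>A\<in>\<A>. \<phi> A + \<eta> / b * (\<Sum>y\<in>Y. if y \<in> A then \<phi> A else 0) - \<eta> * (if x \<in> A then \<phi> A else 0))"
    unfolding danger_def by (rule sum_mono)
  also have "\<dots> = danger a \<eta> \<A> M B + \<eta> / b * (\<Sum>A\<in>\<A>. \<Sum>y\<in>Y. if y \<in> A then \<phi> A else 0)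
      - \<eta> * danger_at a \<eta> \<A> M B x"
    by (simp add: at sum.distrib sum_subtractf sum_distrib_left danger_def \<phi>_def)
  also have "(\<Sum>A\<in>\<A>. \<Sum>y\<in>Y. if y \<in> A then \<phi> A else 0) = (\<Sum>y\<in>Y. danger_at a \<eta> \<A> M B y)"
    unfolding at by (rule sum.swap)
  also have "\<dots> \<le> real (card Y) * danger_at a \<eta> \<A> M B x"
    using max by (rule sum_bounded_above)
  also have "\<dots> \<le> real b * danger_at a \<eta> \<A> M B x"
    using assms(10) \<phi> by (intro mult_right_mono) (auto simp: at intro!: sum_nonneg)
  finally show ?thesis using assms(2) \<open>0 \<le> \<eta>\<close> by (simp add: mult_left_mono divide_right_mono)
qed

lemma danger_stage:
  assumes "finite X" "finite \<A>" "b \<ge> 1" "0 \<le> a" "(1 + a) ^ b = 1 + \<eta>" "\<eta> \<le> 1"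
    and "legal_stage b X rs" "stage_follows (greedy a \<eta> \<A> X) rs"
  shows "danger a \<eta> \<A> (maker_claims rs) (breaker_claims rs) \<le> card \<A>"
  using assms(7,8)
proof induction
  case start
  then show ?case by (simp add: danger_def)
next
  case (round rs x Y)
  let ?M = "maker_claims rs" and ?B = "breaker_claims rs"
  have x: "x = greedy a \<eta> \<A> X rs" using round.prems by simp
  note sub = legal_stage_claims[OF round.hyps(1)]
  have "danger a \<eta> \<A> (insert x ?M) (?B \<union> Y) \<le> danger a \<eta> \<A> ?M ?B"
  proof (rule danger_round[OF assms(2-6)])
    show "finite ?M" "finite ?B" using sub(1,2)[THEN finite_subset] assms(1) by auto
    show "x \<notin> ?M" "Y \<inter> ?B = {}" using round.hyps by (auto simp: unclaimed_def)
    show "danger_at a \<eta> \<A> ?M ?B y \<le> danger_at a \<eta> \<A> ?M ?B x" if "y \<in> Y" for y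
      unfolding x using that round.hyps by (intro greedy(2) assms(1)) auto
  qed (use round.hyps in auto)
  then show ?case using round by simp
qed

lemma ln_one_minus_ge:
  fixes x :: real
  assumes "0 \<le> x" "x \<le> 1 / 2"
  shows "- x - x\<^sup>2 * 2 \<le> ln (1 - x)"
  using ln_one_minus_pos_lower_bound[OF assms] assms
  by (smt (verit) zero_le_power2)

text \<open>The term of \<open>A\<close> alone is at most the total danger, hence at most
  \<open>card \<A>\<close>. Taking logarithms and multiplying by \<open>b\<close> compares
  \<open>n * \<eta>\<close> with \<open>b * m * \<eta>\<close>, since
  \<open>b * ln (1 + a) = ln (1 + \<eta>)\<close>. So \<open>n\<close> is at most about
  \<open>b * m\<close>. The size condition on \<open>A \<inter> X\<close> makes the term
  \<open>b * ln (card \<A>)\<close> as small as the second-order errors of the logarithms.\<close>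

lemma greedy_stage:
  assumes "finite X" "finite \<A>" "b \<ge> 1" "0 < \<eta>" "\<eta> \<le> 1 / 4" "(1 + a) ^ b = 1 + \<eta>" "0 \<le> a"
    and "complete_stage b X rs" "stage_follows (greedy a \<eta> \<A> X) rs"
    and "A \<in> \<A>" "real b * ln (card \<A>) / \<eta>\<^sup>2 \<le> card (A \<inter> X)"
  shows "(1 - 4 * \<eta>) / (real b + 1) * card (A \<inter> X) \<le> card (A \<inter> maker_claims rs)"
proof -
  let ?M = "maker_claims rs" and ?B = "breaker_claims rs"
  define m n where "m = card (A \<inter> ?M)" and "n = card (A \<inter> ?B)"
  have M: "?M \<subseteq> X" "?B = X - ?M" using complete_stage_claims[OF assms(8)] by auto
  then have "A \<inter> X = (A \<inter> ?M) \<union> (A \<inter> ?B)" by auto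
  then have N: "card (A \<inter> X) = m + n"
    unfolding m_def n_def using M assms(1) finite_subset[OF M(1)] by (subst card_Un_disjoint[symmetric]) auto
  define L where "L = ln (real (card \<A>))"
  have "card \<A> \<ge> 1" using assms(2,10) by (metis One_nat_def Suc_leI card_gt_0_iff empty_iff)
  have "(1 + a) ^ n * (1 - \<eta>) ^ m \<le> danger a \<eta> \<A> ?M ?B"
    unfolding m_def n_def danger_def using assms(2,5,7,10)
    by (intro member_le_sum[where f = "\<lambda>A. (1 + a) ^ card (A \<inter> ?B) * (1 - \<eta>) ^ card (A \<inter> ?M)"]) auto
  also have "\<dots> \<le> card \<A>"
    using assms by (intro danger_stage) (auto simp: complete_stage_def)
  finally have "ln ((1 + a) ^ n * (1 - \<eta>) ^ m) \<le> L"
    using assms(5,7) \<open>card \<A> \<ge> 1\<close> unfolding L_def by (subst ln_le_cancel_iff) auto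
  then have "real n * ln (1 + a) + real m * ln (1 - \<eta>) \<le> L"
    using assms(5,7) by (simp add: ln_mult ln_realpow)
  then have le: "real n * (real b * ln (1 + a)) + real b * (real m * ln (1 - \<eta>)) \<le> real b * L"
    using mult_left_mono[of "real n * ln (1 + a) + real m * ln (1 - \<eta>)" L "real b"]
    by (simp add: algebra_simps)
  have "real b * ln (1 + a) = ln (1 + \<eta>)"
    using assms(6,7) by (metis add_nonneg_pos ln_realpow zero_less_one add.commute)
  moreover have "\<eta> - \<eta>\<^sup>2 \<le> ln (1 + \<eta>)"
    using ln_one_plus_pos_lower_bound[of \<eta>] assms(4,5) by simp
  ultimately have "real n * (\<eta> - \<eta>\<^sup>2) \<le> real n * (real b * ln (1 + a))"
    by (intro mult_left_mono) auto
  moreover have "real b * (real m * (- \<eta> - \<eta>\<^sup>2 * 2)) \<le> real b * (real m * ln (1 - \<eta>))"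
    using ln_one_minus_ge[of \<eta>] assms(4,5) by (intro mult_left_mono) auto
  moreover have "real b * L \<le> \<eta>\<^sup>2 * (real m + real n)"
    using assms(4,11) N by (simp add: L_def field_simps)
  ultimately have "real n * (\<eta> - \<eta>\<^sup>2) + real b * (real m * (- \<eta> - \<eta>\<^sup>2 * 2)) \<le> \<eta>\<^sup>2 * (real m + real n)"
    using le by linarith
  then have "\<eta> * (real n * (1 - \<eta>)) \<le> \<eta> * (real b * real m * (1 + 2 * \<eta>) + \<eta> * (real m + real n))"
    by (simp add: algebra_simps power2_eq_square)
  then have "real n * (1 - \<eta>) \<le> real b * real m * (1 + 2 * \<eta>) + \<eta> * (real m + real n)"
    using assms(4) by simp
  then have "(real m + real n) * (1 - 2 * \<eta>) \<le> real b * real m * (1 + 2 * \<eta>) + (1 - \<eta>) * real m"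
    by (simp add: algebra_simps)
  also have "\<dots> \<le> (real b + 1) * real m * (1 + 2 * \<eta>)"
    using assms(4) by (simp add: algebra_simps)
  finally have "(real m + real n) * (1 - 2 * \<eta>) \<le> (real b + 1) * real m * (1 + 2 * \<eta>)" .
  \<comment> \<open>The multiplier clears \<open>1 + 2 * \<eta>\<close> on the right, as the product
    is at most 1, and leaves a square that is at least \<open>1 - 4 * \<eta>\<close> on the
    left.\<close>
  then have "(1 - 2 * \<eta>) * ((real m + real n) * (1 - 2 * \<eta>)) \<le> (1 - 2 * \<eta>) * ((real b + 1) * real m * (1 + 2 * \<eta>))"
    using assms(5) by (intro mult_left_mono) auto
  also have "\<dots> = (real b + 1) * real m * (1 - 4 * \<eta>\<^sup>2)"
    by (simp add: algebra_simps power2_eq_square)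
  also have "\<dots> \<le> (real b + 1) * real m"
    by (intro mult_left_le) auto
  also have "(1 - 2 * \<eta>) * ((real m + real n) * (1 - 2 * \<eta>)) = (real m + real n) * (1 - 4 * \<eta> + 4 * \<eta>\<^sup>2)"
    by (simp add: algebra_simps power2_eq_square)
  finally have "(real m + real n) * (1 - 4 * \<eta> + 4 * \<eta>\<^sup>2) \<le> (real b + 1) * real m" .
  moreover have "(real m + real n) * (1 - 4 * \<eta>) \<le> (real m + real n) * (1 - 4 * \<eta> + 4 * \<eta>\<^sup>2)"
    by (intro mult_left_mono) auto
  ultimately have "(real m + real n) * (1 - 4 * \<eta>) \<le> (real b + 1) * real m" by linarith
  then show ?thesis unfolding N m_def[symmetric] by (simp add: field_simps)
qed

text \<open>The same family serves in all stages, through its traces on the shrinking boards.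
  \<open>large\<close> is imposed on the smallest guaranteed trace, the one after \<open>s\<close>
  stages, so the size condition of \<open>greedy_stage\<close> holds in every stage before.\<close>

lemma maker_keeps_proportion:
  assumes "finite X" "finite \<A>" "\<And>A. A \<in> \<A> \<Longrightarrow> A \<subseteq> X" "b \<ge> 1" "0 < \<eta>" "\<eta> \<le> 1 / 4"
    and large: "\<And>A. A \<in> \<A> \<Longrightarrow>
      real b * ln (card \<A>) / \<eta>\<^sup>2 \<le> ((1 - 4 * \<eta>) / (real b + 1)) ^ s * card A"
  obtains \<sigma> where "maker_strategy b X \<sigma>"
    "\<And>hs A. legal_history b X hs \<Longrightarrow> length hs = s \<Longrightarrow> follows \<sigma> hs \<Longrightarrow> A \<in> \<A> \<Longrightarrow>
      ((1 - 4 * \<eta>) / (real b + 1)) ^ s * card A \<le> card (A \<inter> current_board X hs)"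
proof -
  define a where "a = root b (1 + \<eta>) - 1"
  have "1 + a = root b (1 + \<eta>)" by (simp add: a_def)
  moreover have "1 \<le> root b (1 + \<eta>)"
    using assms(4,5) by simp
  ultimately have "0 \<le> a" by linarith
  moreover have "(1 + a) ^ b = 1 + \<eta>"
    using assms(4,5) real_root_pow_pos2[of b "1 + \<eta>"] by (simp add: a_def)
  ultimately have a: "(1 + a) ^ b = 1 + \<eta>" "0 \<le> a" by auto
  define \<sigma> where "\<sigma> hs rs = greedy a \<eta> \<A> (current_board X hs) rs" for hs rs
  let ?r = "(1 - 4 * \<eta>) / (real b + 1)"
  have r: "0 \<le> ?r" "?r \<le> 1" using assms(5,6) by (auto intro!: divide_nonneg_nonneg simp: divide_le_eq_1)
  have fin: "legal_history b X hs \<Longrightarrow> finite (current_board X hs)" for hs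
    using finite_subset[OF legal_history_board assms(1)] by simp
  have strat: "maker_strategy b X \<sigma>"
    unfolding maker_strategy_def \<sigma>_def by (auto intro!: greedy(1) fin)
  have "?r ^ length hs * card A \<le> card (A \<inter> current_board X hs)"
    if "legal_history b X hs" "follows \<sigma> hs" "length hs \<le> s" "A \<in> \<A>" for hs A
    using that
  proof (induction rule: legal_history.induct)
    case start
    then show ?case using assms(3)[of A] by (simp add: Int_absorb2)
  next
    case (stage hs rs)
    let ?Y = "current_board X hs"
    have le: "?r ^ length hs * card A \<le> card (A \<inter> ?Y)" using stage by simp
    have "?r ^ s * card A \<le> ?r ^ length hs * card A"
      using stage.prems(2) r by (intro mult_right_mono power_decreasing) auto
    then have "real b * ln (card \<A>) / \<eta>\<^sup>2 \<le> card (A \<inter> ?Y)"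
      using large[OF stage.prems(3)] le by linarith
    moreover have "stage_follows (greedy a \<eta> \<A> ?Y) rs"
      using stage.prems(1) by (simp add: \<sigma>_def)
    ultimately have "?r * card (A \<inter> ?Y) \<le> card (A \<inter> maker_claims rs)"
      by (intro greedy_stage[OF fin[OF stage.hyps(1)] assms(2,4-6) a stage.hyps(2)] stage.prems(3))
    moreover have "?r * (?r ^ length hs * card A) \<le> ?r * card (A \<inter> ?Y)"
      using le r by (intro mult_left_mono) auto
    ultimately show ?case by (simp add: mult.assoc)
  qed
  then show thesis using that strat by blast
qed

section \<open>Pancyclicity of joined graphs\<close>

text \<open>Sets of size exactly \<open>k\<close> keep the number of pairs that Maker has to control
  small; \<open>joinedD\<close> passes to larger sets.\<close>

definition joined :: "nat \<Rightarrow> 'v set \<Rightarrow> 'v set set \<Rightarrow> bool" where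
  "joined k V E \<longleftrightarrow> (\<forall>U W. U \<subseteq> V \<and> W \<subseteq> V \<and> U \<inter> W = {} \<and> card U = k \<and> card W = k \<longrightarrow>
     (\<exists>u\<in>U. \<exists>w\<in>W. {u, w} \<in> E))"

definition nbrs :: "'v set \<Rightarrow> 'v set set \<Rightarrow> 'v \<Rightarrow> 'v set" where
  "nbrs V E v = {u \<in> V. {v, u} \<in> E}"

lemma joinedD:
  assumes "joined k V E" "U \<subseteq> V" "W \<subseteq> V" "U \<inter> W = {}" "k \<le> card U" "k \<le> card W"
  shows "\<exists>u\<in>U. \<exists>w\<in>W. {u, w} \<in> E"
proof -
  obtain U' W' where UW: "U' \<subseteq> U" "card U' = k" "W' \<subseteq> W" "card W' = k"
    using assms(5,6) obtain_subset_with_card_n by metis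
  then have "U' \<subseteq> V" "W' \<subseteq> V" "U' \<inter> W' = {}" using assms by auto
  then have "\<exists>u\<in>U'. \<exists>w\<in>W'. {u, w} \<in> E" using assms(1) UW by (simp add: joined_def)
  then show ?thesis using UW by auto
qed

lemma joined_subset: "joined k V E \<Longrightarrow> S \<subseteq> V \<Longrightarrow> joined k S E"
  by (simp add: joined_def subset_trans[of _ S V])

abbreviation path :: "'v set set \<Rightarrow> 'v list \<Rightarrow> bool" where
  "path E \<equiv> successively (\<lambda>u v. {u, v} \<in> E)"

lemma path_rev [simp]: "path E (rev vs) \<longleftrightarrow> path E vs"
  by (simp add: insert_commute)

lemma is_cycleI:
  assumes "path E vs" "{last vs, hd vs} \<in> E" "distinct vs" "set vs \<subseteq> V" "3 \<le> length vs"
  shows "is_cycle V E vs"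
proof -
  have "{vs ! i, vs ! (Suc i mod length vs)} \<in> E" if "i < length vs" for i
  proof (cases "Suc i < length vs")
    case True
    then show ?thesis using assms(1) by (simp add: successively_conv_nth)
  next
    case False
    then have "Suc i = length vs" using that by simp
    then show ?thesis using assms(2,5) last_conv_nth[of vs] hd_conv_nth[of vs]
      by (metis diff_Suc_1 length_0_conv mod_self not_numeral_le_zero)
  qed
  then show ?thesis using assms by (simp add: is_cycle_def)
qed

text \<open>Take the least \<open>t\<close> up to which \<open>I\<close> has \<open>k\<close>
  elements. Then it has no more than \<open>k\<close> there, and so at least \<open>k\<close> beyond
  \<open>t\<close>. Since \<open>J\<close> has \<open>k\<close> elements on one side of
  \<open>t\<close>, it can be matched with the part of \<open>I\<close> on the other side.\<close>

lemma split_index_sets: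
  fixes I J :: "nat set"
  assumes "finite I" "finite J" "2 * k \<le> card I" "2 * k \<le> card J" "1 \<le> k"
  obtains t where "k \<le> card {i \<in> I. i \<le> t}" "k \<le> card {j \<in> J. t \<le> j}"
    | t where "k \<le> card {i \<in> I. t < i}" "k \<le> card {j \<in> J. j < t}"
proof -
  let ?P = "\<lambda>t. k \<le> card {i \<in> I. i \<le> t}"
  have "{i \<in> I. i \<le> Max I} = I" using assms(1) by auto
  then have ex: "?P (Max I)" using assms(3) by simp
  define t where "t = (LEAST t. ?P t)"
  have t: "?P t" unfolding t_def using ex by (rule LeastI)
  have "card {i \<in> I. i < t} < k"
  proof (cases t)
    case 0
    then show ?thesis using assms(5) by simp
  next
    case (Suc t')
    then have "\<not> ?P t'" unfolding t_def by (metis lessI not_less_Least)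
    then show ?thesis using Suc by (simp add: less_Suc_eq_le)
  qed
  moreover have "{i \<in> I. i \<le> t} \<subseteq> insert t {i \<in> I. i < t}" by auto
  then have "card {i \<in> I. i \<le> t} \<le> Suc (card {i \<in> I. i < t})"
    using assms(1) card_mono[of "insert t {i \<in> I. i < t}"] by (auto simp: card_insert_if split: if_splits)
  ultimately have "card {i \<in> I. i \<le> t} \<le> k" by simp
  moreover have "I = {i \<in> I. i \<le> t} \<union> {i \<in> I. t < i}" by auto
  then have "card I \<le> card {i \<in> I. i \<le> t} + card {i \<in> I. t < i}" by (metis card_Un_le)
  ultimately have right: "k \<le> card {i \<in> I. t < i}" using assms(3) by simp
  have "J = {j \<in> J. t \<le> j} \<union> {j \<in> J. j < t}" by auto
  then have "card J \<le> card {j \<in> J. t \<le> j} + card {j \<in> J. j < t}" by (metis card_Un_le)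
  then have "k \<le> card {j \<in> J. t \<le> j} \<or> k \<le> card {j \<in> J. j < t}" using assms(4) by linarith
  then show thesis using that t right by blast
qed

text \<open>
  Posa rotations at both ends produce \<open>k\<close> possible first and \<open>k\<close> possible last vertices. The two
  cases of the previous lemma make the rotations at the two ends compatible.
\<close>

lemma close_path:
  assumes joined: "joined k S E" "1 \<le> k"
    and p: "path E vs" "distinct vs" "set vs \<subseteq> S" "vs \<noteq> []"
    and deg: "2 * k \<le> card (nbrs (set vs) E (hd vs))" "2 * k \<le> card (nbrs (set vs) E (last vs))"
    and loop: "\<And>v. {v} \<notin> E"
  obtains ws where "path E ws" "{last ws, hd ws} \<in> E" "distinct ws" "set ws = set vs"
proof (cases "{last vs, hd vs} \<in> E")
  case True
  then show thesis using that p by blast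
next
  case False
  define m where "m = length vs"
  have m: "0 < m" using p(4) by (simp add: m_def)
  have hdl: "hd vs = vs ! 0" "last vs = vs ! (m - 1)"
    using p(4) by (auto simp: m_def hd_conv_nth last_conv_nth)
  define I where "I = {i. i < m \<and> {hd vs, vs ! i} \<in> E}"
  define J where "J = {i. i < m \<and> {last vs, vs ! i} \<in> E}"
  have img: "nbrs (set vs) E v = (!) vs ` {i. i < m \<and> {v, vs ! i} \<in> E}" for v
    unfolding nbrs_def m_def by (auto simp: in_set_conv_nth)
  have fin: "finite I" "finite J" by (auto simp: I_def J_def)
  have card: "2 * k \<le> card I" "2 * k \<le> card J"
    using deg card_image_le[OF fin(1), of "(!) vs"] card_image_le[OF fin(2), of "(!) vs"]
    unfolding img I_def J_def by auto
  have I: "1 \<le> i \<and> i < m - 1" if "i \<in> I" for i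
  proof -
    have "i \<noteq> 0" using that loop[of "vs ! 0"] hdl by (cases i) (auto simp: I_def)
    moreover have "i \<noteq> m - 1" using that False hdl by (auto simp: I_def insert_commute)
    ultimately show ?thesis using that by (auto simp: I_def)
  qed
  have J: "1 \<le> j \<and> j < m - 1" if "j \<in> J" for j
  proof -
    have "j \<noteq> m - 1" using that loop[of "vs ! (m - 1)"] hdl by (auto simp: J_def)
    moreover have "j \<noteq> 0" using that False hdl by (cases j) (auto simp: J_def)
    ultimately show ?thesis using that by (auto simp: J_def)
  qed
  have inj: "inj_on (\<lambda>i. vs ! (f i)) K" if "inj_on f K" "\<And>i. i \<in> K \<Longrightarrow> f i < m" for f and K :: "nat set"
    using that p(2) unfolding inj_on_def m_def by (metis nth_eq_iff_index_eq)
  have segments: "\<exists>P Q R. vs = P @ Q @ R \<and> P \<noteq> [] \<and> Q \<noteq> [] \<and> R \<noteq> [] \<and>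
      hd Q = vs ! i \<and> last P = vs ! (i - 1) \<and> hd R = vs ! j \<and> last Q = vs ! (j - 1)"
    if "1 \<le> i" "i < j" "j < m" for i j
  proof -
    let ?P = "take i vs" and ?Q = "take (j - i) (drop i vs)" and ?R = "drop j vs"
    have "vs = ?P @ ?Q @ ?R"
      by (metis add.commute append_take_drop_id drop_drop le_add_diff_inverse2 less_imp_le_nat that(2))
    moreover have "last ?Q = vs ! (j - 1)"
      using that by (subst last_conv_nth) (auto simp: m_def)
    moreover have "last ?P = vs ! (i - 1)"
      using that by (subst last_conv_nth) (auto simp: m_def)
    ultimately show ?thesis using that
      by (intro exI[of _ ?P] exI[of _ ?Q] exI[of _ ?R]) (auto simp: m_def hd_drop_conv_nth)
  qed
  have joinedE: "\<exists>i\<in>K. \<exists>j\<in>L. {vs ! (f i), vs ! (g j)} \<in> E"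
    if "k \<le> card K" "k \<le> card L" "inj_on f K" "inj_on g L" "\<And>i. i \<in> K \<Longrightarrow> f i < m"
      "\<And>j. j \<in> L \<Longrightarrow> g j < m" "\<And>i j. i \<in> K \<Longrightarrow> j \<in> L \<Longrightarrow> f i \<noteq> g j"
    for K L :: "nat set" and f g
  proof -
    let ?U = "(\<lambda>i. vs ! f i) ` K" and ?W = "(\<lambda>j. vs ! g j) ` L"
    have "?U \<subseteq> S" "?W \<subseteq> S" using p(3) that(5,6) by (auto simp: m_def)
    moreover have "?U \<inter> ?W = {}"
      using that(5-7) p(2) by (auto simp: m_def nth_eq_iff_index_eq)
    moreover have "card ?U = card K" "card ?W = card L"
      using inj that by (auto intro!: card_image)
    ultimately have "\<exists>u\<in>?U. \<exists>w\<in>?W. {u, w} \<in> E"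
      using that(1,2) by (intro joinedD[OF joined(1)]) simp_all
    then show ?thesis by simp
  qed
  from split_index_sets[OF fin card joined(2)]
  show thesis
  proof cases
    case (1 t)
    let ?K = "{i \<in> I. i \<le> t}" and ?L = "{j \<in> J. t \<le> j}"
    have "inj_on (\<lambda>i. i - 1) ?K" using I by (intro inj_on_diff_nat) simp
    moreover have "i - 1 \<noteq> Suc j" if "i \<in> ?K" "j \<in> ?L" for i j using that by auto
    moreover have "Suc j < m" if "j \<in> ?L" for j using J that by fastforce
    moreover have "i - 1 < m" if "i \<in> ?K" for i using I that by fastforce
    ultimately obtain i j where ij: "i \<in> ?K" "j \<in> ?L" "{vs ! (i - 1), vs ! Suc j} \<in> E"
      using joinedE[of ?K ?L "\<lambda>i. i - 1" Suc] 1 by auto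
    \<comment> \<open>The chord from \<open>vs ! 0\<close> to \<open>vs ! i\<close> makes
      \<open>vs ! (i - 1)\<close> the new first vertex, the chord from the last vertex to
      \<open>vs ! j\<close> makes \<open>vs ! Suc j\<close> the new last one, and
      \<open>i \<le> j\<close> lets both rotations act on disjoint ends of the path.\<close>
    have "1 \<le> i" "i < Suc j" "Suc j < m" using I[of i] J[of j] ij by auto
    from segments[OF this] obtain P Q R where vs: "vs = P @ Q @ R" "P \<noteq> []" "Q \<noteq> []" "R \<noteq> []"
      "hd Q = vs ! i" "last P = vs ! (i - 1)" "hd R = vs ! Suc j" "last Q = vs ! j" by auto
    have "{hd P, hd Q} \<in> E" "{last Q, last R} \<in> E" "{last P, hd R} \<in> E"
      using ij vs by (auto simp: I_def J_def insert_commute)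
    then show thesis
      using p vs(1-4)
      by (intro that[of "rev P @ Q @ rev R"])
        (auto simp: successively_append_iff hd_rev last_rev insert_commute)
  next
    case (2 t)
    let ?K = "{i \<in> I. t < i}" and ?L = "{j \<in> J. j < t}"
    have "inj_on (\<lambda>i. i - 1) ?K" "inj_on (\<lambda>i. i - 1) ?L" using I J by (auto intro!: inj_on_diff_nat)
    moreover have "i - 1 \<noteq> j - 1" if "i \<in> ?K" "j \<in> ?L" for i j using that J[of j] by auto
    moreover have "j - 1 < m" if "j \<in> ?L" for j using J that by fastforce
    moreover have "i - 1 < m" if "i \<in> ?K" for i using I that by fastforce
    ultimately obtain i j where ij: "i \<in> ?K" "j \<in> ?L" "{vs ! (i - 1), vs ! (j - 1)} \<in> E"
      using joinedE[of ?K ?L "\<lambda>i. i - 1" "\<lambda>i. i - 1"] 2 by auto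
    \<comment> \<open>Now the chords cross. The new ends are \<open>vs ! (i - 1)\<close> and
      \<open>vs ! (j - 1)\<close>, and the two chords link the three pieces in a different
      order.\<close>
    have "1 \<le> j" "j < i" "i < m" using I[of i] J[of j] ij by auto
    from segments[OF this] obtain P Q R where vs: "vs = P @ Q @ R" "P \<noteq> []" "Q \<noteq> []" "R \<noteq> []"
      "hd Q = vs ! j" "last P = vs ! (j - 1)" "hd R = vs ! i" "last Q = vs ! (i - 1)" by auto
    have "{hd Q, last R} \<in> E" "{hd R, hd P} \<in> E" "{last P, last Q} \<in> E"
      using ij vs by (auto simp: I_def J_def insert_commute)
    then show thesis
      using p vs(1-4)
      by (intro that[of "rev Q @ rev R @ P"])
        (auto simp: successively_append_iff hd_rev last_rev insert_commute)
  qed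
qed

text \<open>The cycle is opened next to \<open>v\<close>, which gives a path starting at
  \<open>v\<close> that \<open>u\<close> can be put in front of.\<close>

lemma cycle_extend:
  assumes "path E ws" "{last ws, hd ws} \<in> E" "distinct ws" "v \<in> set ws" "{u, v} \<in> E" "u \<notin> set ws"
  obtains vs where "path E vs" "distinct vs" "set vs = insert u (set ws)"
proof -
  obtain xs ys where ws: "ws = xs @ v # ys" using assms(4) by (meson split_list)
  have "path E (v # ys @ xs)"
  proof (cases "xs = []")
    case False
    then show ?thesis using assms(1,2) ws
      by (cases "ys = []") (auto simp: successively_append_iff successively_Cons)
  qed (use assms(1) ws in auto)
  then have "path E (u # v # ys @ xs)" using assms(5) by simp
  then show thesis using assms(3,6) ws by (intro that[of "u # v # ys @ xs"]) auto
qed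

text \<open>All neighbours of the ends of a longest path lie on it, so \<open>close_path\<close>
  yields a cycle on the same vertices. If vertices are missing, an edge leaves the cycle: by
  joinedness if at least \<open>k\<close> are missing, otherwise because a missing vertex has too
  many neighbours to have them all among the missing ones. Opening the cycle there contradicts
  maximality.\<close>

lemma hamiltonian:
  assumes "finite S" "S \<noteq> {}" "joined k S E" "1 \<le> k" "\<And>v. {v} \<notin> E"
    and deg: "\<And>v. v \<in> S \<Longrightarrow> 2 * k + 1 \<le> card (nbrs S E v)"
  obtains ws where "path E ws" "{last ws, hd ws} \<in> E" "distinct ws" "set ws = S"
proof -
  let ?P = "\<lambda>vs. path E vs \<and> distinct vs \<and> set vs \<subseteq> S"
  obtain v0 where "v0 \<in> S" using assms(2) by blast
  then have "?P [v0]" by simp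
  moreover have "\<forall>vs. ?P vs \<longrightarrow> length vs < Suc (card S)"
    using assms(1) by (metis card_mono distinct_card less_Suc_eq_le)
  ultimately obtain vs where vs: "?P vs" and max: "\<And>vs'. ?P vs' \<Longrightarrow> length vs' \<le> length vs"
    using ex_has_greatest_nat[of ?P "[v0]" length "Suc (card S)"] by blast
  have "vs \<noteq> []" using max[OF \<open>?P [v0]\<close>] by auto
  have "u \<in> set vs" if "u \<in> S" "{hd vs, u} \<in> E" for u
    using max[of "u # vs"] that vs \<open>vs \<noteq> []\<close> by (cases vs) (auto simp: insert_commute)
  then have hd: "nbrs (set vs) E (hd vs) = nbrs S E (hd vs)" using vs by (auto simp: nbrs_def)
  have "u \<in> set vs" if "u \<in> S" "{last vs, u} \<in> E" for u
    using max[of "vs @ [u]"] that vs \<open>vs \<noteq> []\<close> by (auto simp: successively_append_iff)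
  then have last: "nbrs (set vs) E (last vs) = nbrs S E (last vs)" using vs by (auto simp: nbrs_def)
  have "hd vs \<in> S" "last vs \<in> S" using vs \<open>vs \<noteq> []\<close> by auto
  then have degs: "2 * k + 1 \<le> card (nbrs (set vs) E (hd vs))" "2 * k + 1 \<le> card (nbrs (set vs) E (last vs))"
    unfolding hd last using deg by auto
  then obtain ws where ws: "path E ws" "{last ws, hd ws} \<in> E" "distinct ws" "set ws = set vs"
    using close_path[OF assms(3,4), of vs] vs \<open>vs \<noteq> []\<close> assms(5) by (metis add_leD1)
  have "set ws = S"
  proof (rule ccontr)
    assume "set ws \<noteq> S"
    have "set ws \<subseteq> S" using ws(4) vs by simp
    have "\<exists>u \<in> S - set ws. \<exists>v \<in> set ws. {u, v} \<in> E"
    proof (cases "k \<le> card (S - set ws)")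
      case True
      have "nbrs (set vs) E (hd vs) \<subseteq> set ws" using ws(4) by (auto simp: nbrs_def)
      then have "card (nbrs (set vs) E (hd vs)) \<le> card (set ws)" by (intro card_mono) auto
      then have "k \<le> card (set ws)" using degs by linarith
      then show ?thesis
        using joinedD[OF assms(3), of "S - set ws" "set ws"] True \<open>set ws \<subseteq> S\<close> by auto
    next
      case False
      obtain u where u: "u \<in> S - set ws" using \<open>set ws \<noteq> S\<close> \<open>set ws \<subseteq> S\<close> by blast
      have "\<not> nbrs S E u \<subseteq> S - set ws"
      proof
        assume "nbrs S E u \<subseteq> S - set ws"
        then have "card (nbrs S E u) \<le> card (S - set ws)" using assms(1) by (intro card_mono) auto
        then show False using False deg[of u] u by simp
      qed
      then show ?thesis using u by (auto simp: nbrs_def)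
    qed
    then obtain u v where uv: "u \<in> S - set ws" "v \<in> set ws" "{u, v} \<in> E" by blast
    then obtain vs' where vs': "path E vs'" "distinct vs'" "set vs' = insert u (set ws)"
      using cycle_extend[OF ws(1-3)] by (metis DiffD2)
    then have "?P vs'" using uv \<open>set ws \<subseteq> S\<close> by auto
    from max[OF this] have "card (set vs') \<le> card (set vs)" using vs vs'(2) by (simp add: distinct_card)
    then show False using vs'(3) ws(4) uv by (simp add: card_insert_if)
  qed
  then show thesis using that ws by blast
qed

lemma card_nbrs_subset:
  assumes "finite V" "S \<subseteq> V"
  shows "card (nbrs V E v) \<le> card (nbrs S E v) + card (V - S)"
proof -
  have "nbrs V E v \<subseteq> nbrs S E v \<union> (V - S)" by (auto simp: nbrs_def)
  then have "card (nbrs V E v) \<le> card (nbrs S E v \<union> (V - S))"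
    using assms finite_subset[OF assms(2)] by (intro card_mono) (auto simp: nbrs_def)
  also have "\<dots> \<le> card (nbrs S E v) + card (V - S)" by (rule card_Un_le)
  finally show ?thesis .
qed

text \<open>
  Cycles of length up to about \<open>card V - 4 * k\<close> are \<open>x, a, Q, c\<close> with \<open>a, c\<close> among the neighbours of \<open>x\<close>
  and \<open>Q\<close> a piece of a Hamilton cycle of the rest; longer ones are Hamilton cycles of subgraphs.
\<close>

lemma joined_pancyclic:
  assumes "finite V" "joined k V E" "1 \<le> k" "\<And>v. {v} \<notin> E"
    and deg: "\<And>v. v \<in> V \<Longrightarrow> 7 * k + 3 \<le> card (nbrs V E v)"
  shows "pancyclic V E"
  unfolding pancyclic_def
proof (intro allI impI)
  fix l assume l: "3 \<le> l \<and> l \<le> card V"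
  then obtain x where x: "x \<in> V" by fastforce
  have ham: "\<exists>ws. path E ws \<and> {last ws, hd ws} \<in> E \<and> distinct ws \<and> set ws = S"
    if S: "S \<subseteq> V" "card (V - S) \<le> 4 * k + 1" for S
  proof -
    have degS: "2 * k + 1 \<le> card (nbrs S E v)" if "v \<in> V" for v
      using deg[OF that] card_nbrs_subset[OF assms(1) S(1), of E v] S(2) by simp
    have "S \<noteq> {}" using degS[OF x] by (auto simp: nbrs_def)
    moreover have "finite S" using S(1) assms(1) by (rule finite_subset)
    moreover have "2 * k + 1 \<le> card (nbrs S E v)" if "v \<in> S" for v
      using degS that S(1) by blast
    ultimately obtain ws where "path E ws" "{last ws, hd ws} \<in> E" "distinct ws" "set ws = S"
      using hamiltonian[OF _ _ joined_subset[OF assms(2) S(1)] assms(3,4)] by blast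
    then show ?thesis by blast
  qed
  obtain C where C: "C \<subseteq> nbrs V E x" "card C = 2 * k"
    using deg[OF x] obtain_subset_with_card_n[of "2 * k" "nbrs V E x"] by auto
  obtain A where A: "A \<subseteq> C" "card A = k" using C(2) obtain_subset_with_card_n[of k C] by auto
  define B where "B = C - A"
  have finC: "finite C" using C(2) assms(3) by (intro card_ge_0_finite) simp
  have AV: "A \<subseteq> nbrs V E x" "finite A" using A(1) C(1) finC finite_subset by auto
  have BV: "B \<subseteq> nbrs V E x" "finite B" "A \<inter> B = {}" "card B = k"
    using B_def C A finC AV(2) card_Diff_subset[of A C] by auto
  have nV: "nbrs V E x \<subseteq> V" "x \<notin> nbrs V E x" using assms(4) by (auto simp: nbrs_def)
  have subV: "A \<subseteq> V" "B \<subseteq> V" using AV BV nV by auto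
  show "\<exists>vs. is_cycle V E vs \<and> length vs = l"
  proof (cases "l = 3")
    case True
    \<comment> \<open>Here \<open>Q\<close> would be empty, so \<open>a\<close> and \<open>c\<close>
      have to be adjacent themselves.\<close>
    obtain a c where ac: "a \<in> A" "c \<in> B" "{a, c} \<in> E"
      using joinedD[OF assms(2) subV BV(3)] A(2) BV(4) by auto
    then have "{x, a} \<in> E" "{c, x} \<in> E" using AV BV by (auto simp: nbrs_def insert_commute)
    moreover have "distinct [x, a, c]" using ac AV BV nV by auto
    ultimately have "is_cycle V E [x, a, c]" using ac AV BV nV x by (intro is_cycleI) auto
    then show ?thesis using True by (intro exI[of _ "[x, a, c]"]) auto
  next
    case False
    define lost where "lost Z = {v \<in> V - Z. \<forall>z \<in> Z. {v, z} \<notin> E}" for Z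
    have lost: "card (lost Z) \<le> k" if Z: "Z \<subseteq> V" "card Z = k" for Z
    proof (rule ccontr)
      assume "\<not> card (lost Z) \<le> k"
      moreover have "lost Z \<subseteq> V" "lost Z \<inter> Z = {}" by (auto simp: lost_def)
      ultimately obtain u w where "u \<in> lost Z" "w \<in> Z" "{u, w} \<in> E"
        using joinedD[OF assms(2), of "lost Z" Z] Z by auto
      then show False by (auto simp: lost_def)
    qed
    \<comment> \<open>Every vertex outside \<open>D\<close> has neighbours in both \<open>A\<close>
      and \<open>B\<close>, so any piece of a Hamilton cycle of the rest can be extended at both
      ends. \<open>D\<close> is small enough for the minimum degree \<open>7 * k + 3\<close> to
      survive its removal.\<close>
    define D where "D = insert x (A \<union> B \<union> lost A \<union> lost B)"
    have "card D \<le> Suc (card (A \<union> B \<union> lost A \<union> lost B))" unfolding D_def by (rule card_insert_le_m1) simp_all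
    also have "card (A \<union> B \<union> lost A \<union> lost B) \<le> card A + card B + card (lost A) + card (lost B)"
      by (intro order.trans[OF card_Un_le] add_mono card_Un_le order_refl)
    also have "\<dots> \<le> k + k + k + k"
      using lost[of A] lost[of B] AV BV nV A(2) by (intro add_mono) auto
    finally have D: "card D \<le> 4 * k + 1" by simp
    have "D \<subseteq> V" using x AV BV nV by (auto simp: D_def lost_def)
    define W where "W = V - D"
    have VW: "V - W = D" using \<open>D \<subseteq> V\<close> by (auto simp: W_def)
    show ?thesis
    proof (cases "l - 3 \<le> card W")
      case True
      obtain ws where ws: "path E ws" "distinct ws" "set ws = W"
        using ham[of W] D VW by (auto simp: W_def)
      define Q where "Q = take (l - 3) ws"
      have "length ws = card W" using ws by (metis distinct_card)
      then have lQ: "length Q = l - 3" using True by (simp add: Q_def)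
      then have "Q \<noteq> []" using l False by auto
      have "path E Q" unfolding Q_def using ws(1) by (metis append_take_drop_id successively_append_iff)
      have QW: "set Q \<subseteq> W" "distinct Q" using ws set_take_subset[of "l - 3" ws] by (auto simp: Q_def)
      have nb: "\<exists>z \<in> Z. {v, z} \<in> E" if "v \<in> W" "lost Z \<subseteq> D" "Z \<subseteq> D" for v Z
        using that by (auto simp: W_def lost_def)
      have "hd Q \<in> W" "last Q \<in> W" using QW \<open>Q \<noteq> []\<close> by auto
      then obtain a c where ac: "a \<in> A" "{hd Q, a} \<in> E" "c \<in> B" "{last Q, c} \<in> E"
        using nb[of "hd Q" A] nb[of "last Q" B] by (auto simp: D_def)
      have xa: "{x, a} \<in> E" "{c, x} \<in> E" using ac AV BV by (auto simp: nbrs_def insert_commute)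
      have "path E (x # a # Q @ [c])"
        using xa ac \<open>path E Q\<close> \<open>Q \<noteq> []\<close>
        by (auto simp: successively_Cons successively_append_iff insert_commute)
      moreover have "distinct (x # a # Q @ [c])"
        using ac AV BV nV QW by (auto simp: W_def D_def)
      moreover have "set (x # a # Q @ [c]) \<subseteq> V"
        using ac AV BV nV QW x by (auto simp: W_def)
      ultimately have "is_cycle V E (x # a # Q @ [c])"
        using xa by (intro is_cycleI) auto
      then show ?thesis using lQ l False by (intro exI[of _ "x # a # Q @ [c]"]) auto
    next
      case False
      have "card W = card V - card D"
        unfolding W_def using \<open>D \<subseteq> V\<close> assms(1) by (meson card_Diff_subset finite_subset)
      then have "card V - l \<le> 4 * k + 1" using False D by simp
      moreover obtain S where S: "S \<subseteq> V" "card S = l" using l obtain_subset_with_card_n by metis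
      moreover have "card (V - S) = card V - l"
        using S assms(1) by (metis card_Diff_subset finite_subset)
      ultimately obtain ws where ws: "path E ws" "{last ws, hd ws} \<in> E" "distinct ws" "set ws = S"
        using ham[of S] by auto
      then have "length ws = l" using S by (metis distinct_card)
      then show ?thesis using ws S l by (metis is_cycleI)
    qed
  qed
qed

section \<open>Clusters of triangles\<close>

definition triangles :: "'v set \<Rightarrow> 'v set set set" where
  "triangles V = {{{u, v}, {v, w}, {u, w}} | u v w.
     u \<in> V \<and> v \<in> V \<and> w \<in> V \<and> u \<noteq> v \<and> v \<noteq> w \<and> u \<noteq> w}"

lemma triangle_props:
  assumes "T \<in> triangles V"
  shows "T \<subseteq> complete_edges V" "finite T" "card T = 3"
  using assms by (auto simp: triangles_def complete_edges_def doubleton_eq_iff card_insert_if)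

lemma triangles_card:
  assumes "finite V"
  shows "finite (triangles V)" "card (triangles V) \<le> card V ^ 3"
proof -
  let ?f = "\<lambda>(u, v, w). {{u, v}, {v, w}, {u, w}}"
  have sub: "triangles V \<subseteq> ?f ` (V \<times> V \<times> V)"
  proof
    fix T assume "T \<in> triangles V"
    then obtain u v w where "u \<in> V" "v \<in> V" "w \<in> V" "T = {{u, v}, {v, w}, {u, w}}"
      by (auto simp: triangles_def)
    then show "T \<in> ?f ` (V \<times> V \<times> V)" by (intro image_eqI[of _ _ "(u, v, w)"]) auto
  qed
  then show "finite (triangles V)" using assms finite_subset by blast
  have "card (triangles V) \<le> card (?f ` (V \<times> V \<times> V))" using sub assms by (intro card_mono) auto
  also have "\<dots> \<le> card (V \<times> V \<times> V)" using assms by (intro card_image_le) auto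
  finally show "card (triangles V) \<le> card V ^ 3" by (simp add: power3_eq_cube card_cartesian_product mult.assoc)
qed

text \<open>With one edge in \<open>F\<close>, the triangle is determined by this edge and the
  opposite vertex; with two, the third edge is their symmetric difference. The two images thus bound
  the number of such triangles by \<open>card F * card V\<close> and
  \<open>card F ^ 2\<close>.\<close>

lemma triangle_meets:
  assumes "T \<in> triangles V" "T \<inter> F \<noteq> {}" "\<not> T \<subseteq> F"
  shows "card (T - F) = 2 \<and> T \<in> (\<lambda>(e, w). insert e ((\<lambda>x. {x, w}) ` e)) ` (F \<times> V)
       \<or> card (T - F) = 1 \<and> T \<in> (\<lambda>(e, f). {e, f, (e - f) \<union> (f - e)}) ` (F \<times> F)"
proof -
  have one: ?thesis
    if "u \<in> V" "v \<in> V" "w \<in> V" "u \<noteq> v" "v \<noteq> w" "u \<noteq> w" "T = {{u, v}, {v, w}, {u, w}}"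
      "{u, v} \<in> F" "{v, w} \<notin> F" "{u, w} \<notin> F" for u v w
  proof -
    have "T - F = {{v, w}, {u, w}}" using that by auto
    then have "card (T - F) = 2" using that by (simp add: doubleton_eq_iff)
    moreover have "T = insert {u, v} ((\<lambda>x. {x, w}) ` {u, v})" using that by auto
    ultimately show ?thesis using that by (intro disjI1 conjI image_eqI[of _ _ "({u, v}, w)"]) auto
  qed
  have two: ?thesis
    if "u \<in> V" "v \<in> V" "w \<in> V" "u \<noteq> v" "v \<noteq> w" "u \<noteq> w" "T = {{u, v}, {v, w}, {u, w}}"
      "{u, v} \<in> F" "{v, w} \<in> F" "{u, w} \<notin> F" for u v w
  proof -
    have "T - F = {{u, w}}" using that by auto
    moreover have "({u, v} - {v, w}) \<union> ({v, w} - {u, v}) = {u, w}" using that by auto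
    ultimately show ?thesis using that
      by (intro disjI2 conjI image_eqI[of _ _ "({u, v}, {v, w})"]) auto
  qed
  obtain u v w where T: "u \<in> V" "v \<in> V" "w \<in> V" "u \<noteq> v" "v \<noteq> w" "u \<noteq> w" "T = {{u, v}, {v, w}, {u, w}}"
    using assms(1) by (auto simp: triangles_def)
  have *: "T = {{v, w}, {w, u}, {v, u}}" "T = {{w, u}, {u, v}, {w, v}}"
    "T = {{v, u}, {u, w}, {v, w}}"
    using T(7) by (auto simp: insert_commute)
  \<comment> \<open>Cyclic relabelling of the vertices reduces the six patterns to
    \<open>one\<close> and \<open>two\<close>.\<close>
  consider "{u, v} \<in> F" "{v, w} \<notin> F" "{u, w} \<notin> F" | "{v, w} \<in> F" "{w, u} \<notin> F" "{v, u} \<notin> F"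
    | "{w, u} \<in> F" "{u, v} \<notin> F" "{w, v} \<notin> F" | "{u, v} \<in> F" "{v, w} \<in> F" "{u, w} \<notin> F"
    | "{v, w} \<in> F" "{w, u} \<in> F" "{v, u} \<notin> F" | "{w, u} \<in> F" "{u, v} \<in> F" "{w, v} \<notin> F"
    using assms(2,3) T(7) by (auto simp: insert_commute)
  then show ?thesis
  proof cases
    case 1 then show ?thesis using one[OF T] by simp
  next
    case 2 then show ?thesis using one[OF T(2,3,1) _ _ _ *(1)] T by simp
  next
    case 3 then show ?thesis using one[OF T(3,1,2) _ _ _ *(2)] T by simp
  next
    case 4 then show ?thesis using two[OF T] by simp
  next
    case 5 then show ?thesis using two[OF T(2,3,1) _ _ _ *(1)] T by simp
  next
    case 6 then show ?thesis using two[OF T(3,1,2) _ _ _ *(2)] T by simp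
  qed
qed

text \<open>A new vertex costs two edges, a closing edge only one, whence
  \<open>card V * q ^ 2\<close> and \<open>q\<close>. The estimate
  \<open>card F \<le> card F ^ 2\<close> gives both a common factor.\<close>

lemma triangles_meeting_weight:
  fixes q :: real
  assumes "finite V" "finite F" "0 \<le> q"
  shows "(\<Sum>T | T \<in> triangles V \<and> T \<inter> F \<noteq> {} \<and> \<not> T \<subseteq> F. q ^ card (T - F))
    \<le> (real (card F))\<^sup>2 * (real (card V) * q\<^sup>2 + q)"
proof -
  define S where "S = {T. T \<in> triangles V \<and> T \<inter> F \<noteq> {} \<and> \<not> T \<subseteq> F}"
  define S1 where "S1 = {T \<in> S. card (T - F) = 2}"
  define S2 where "S2 = {T \<in> S. card (T - F) = 1}"
  have "card (T - F) = 2 \<or> card (T - F) = 1" if "T \<in> S" for T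
    using triangle_meets[of T V F] that unfolding S_def by fast
  then have S: "S = S1 \<union> S2" "S1 \<inter> S2 = {}" unfolding S1_def S2_def by auto
  have "finite S" using triangles_card(1)[OF assms(1)] by (simp add: S_def)
  let ?g = "\<lambda>(e, w). insert e ((\<lambda>x. {x, w}) ` e)" and ?h = "\<lambda>(e, f). {e, f, (e - f) \<union> (f - e)}"
  have "S1 \<subseteq> ?g ` (F \<times> V)"
  proof
    fix T assume "T \<in> S1"
    then show "T \<in> ?g ` (F \<times> V)" using triangle_meets[of T V F] unfolding S1_def S_def by fastforce
  qed
  then have "card S1 \<le> card (?g ` (F \<times> V))" using assms by (intro card_mono) auto
  also have "\<dots> \<le> card (F \<times> V)" using assms by (intro card_image_le) auto
  finally have c1: "real (card S1) \<le> real (card F) * card V"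
    by (simp add: card_cartesian_product flip: of_nat_mult)
  have "S2 \<subseteq> ?h ` (F \<times> F)"
  proof
    fix T assume "T \<in> S2"
    then show "T \<in> ?h ` (F \<times> F)" using triangle_meets[of T V F] unfolding S2_def S_def by fastforce
  qed
  then have "card S2 \<le> card (?h ` (F \<times> F))" using assms by (intro card_mono) auto
  also have "\<dots> \<le> card (F \<times> F)" using assms by (intro card_image_le) auto
  finally have c2: "real (card S2) \<le> (real (card F))\<^sup>2"
    by (simp add: card_cartesian_product power2_eq_square flip: of_nat_mult)
  have "card F \<le> (card F)\<^sup>2" by (simp add: power2_eq_square)
  then have sq: "real (card F) \<le> (real (card F))\<^sup>2" by (metis of_nat_le_iff of_nat_power)
  have "(\<Sum>T\<in>S. q ^ card (T - F)) = (\<Sum>T\<in>S1. q ^ card (T - F)) + (\<Sum>T\<in>S2. q ^ card (T - F))"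
    using S \<open>finite S\<close> by (simp add: sum.union_disjoint)
  also have "(\<Sum>T\<in>S1. q ^ card (T - F)) = card S1 * q\<^sup>2"
    by (simp add: S1_def)
  also have "(\<Sum>T\<in>S2. q ^ card (T - F)) = card S2 * q"
    by (simp add: S2_def)
  also have "real (card S1) * q\<^sup>2 + real (card S2) * q
      \<le> ((real (card F))\<^sup>2 * card V) * q\<^sup>2 + (real (card F))\<^sup>2 * q"
  proof (intro add_mono mult_right_mono c2)
    show "real (card S1) \<le> (real (card F))\<^sup>2 * card V"
      using c1 mult_right_mono[OF sq, of "real (card V)"] by simp
  qed (use assms in auto)
  finally show ?thesis unfolding S_def by (simp add: algebra_simps)
qed

text \<open>The index counts attached triangles, so a cluster of index \<open>m\<close> is a union
  of \<open>m + 1\<close> triangles. Requiring \<open>\<not> T \<subseteq> F\<close> makes every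
  attachment add an edge, hence cost at least a factor \<open>q\<close>.\<close>

primrec clusters :: "'v set \<Rightarrow> nat \<Rightarrow> 'v set set set" where
  "clusters V 0 = triangles V"
| "clusters V (Suc m) =
     (\<Union>F \<in> clusters V m. (\<union>) F ` {T \<in> triangles V. T \<inter> F \<noteq> {} \<and> \<not> T \<subseteq> F})"

lemma finite_clusters: "finite V \<Longrightarrow> finite (clusters V m)"
  by (induction m) (auto simp: triangles_card)

lemma cluster_props:
  "F \<in> clusters V m \<Longrightarrow> F \<subseteq> complete_edges V \<and> finite F \<and> card F \<le> 2 * m + 3"
proof (induction m arbitrary: F)
  case 0
  then show ?case using triangle_props[of F V] by simp
next
  case (Suc m)
  then obtain G T where F: "F = G \<union> T" "G \<in> clusters V m" "T \<in> triangles V" "T \<inter> G \<noteq> {}"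
    by auto
  have "card (T - G) < card T" using triangle_props[OF F(3)] F(4) by (intro psubset_card_mono) auto
  moreover have "F = G \<union> (T - G)" using F by auto
  then have "card F \<le> card G + card (T - G)" by (metis card_Un_le)
  ultimately show ?case using Suc.IH[OF F(2)] triangle_props[OF F(3)] F(1) by auto
qed

text \<open>Summing over pairs of a cluster and an attached triangle may count a union repeatedly,
  which is harmless for an upper bound. The \<open>card V ^ 3\<close> stands for the initial
  triangle, whose weight is bounded by 1; the product depends only on \<open>m\<close>.\<close>

lemma clusters_weight:
  fixes q :: real
  assumes "finite V" "0 \<le> q" "q \<le> 1"
  shows "(\<Sum>F\<in>clusters V m. q ^ card F)
    \<le> real (card V) ^ 3 * ((\<Prod>i<m. (2 * real i + 3)\<^sup>2) * (real (card V) * q\<^sup>2 + q) ^ m)"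
proof (induction m)
  case 0
  have "(\<Sum>F\<in>triangles V. q ^ card F) \<le> real (card (triangles V)) * 1"
    using assms by (intro sum_bounded_above) (auto simp: power_le_one)
  also have "\<dots> \<le> real (card V ^ 3)" using triangles_card(2)[OF assms(1)] by (simp only: mult_1_right of_nat_le_iff)
  finally show ?case by simp
next
  case (Suc m)
  let ?\<rho> = "real (card V) * q\<^sup>2 + q" and ?T = "\<lambda>F. {T \<in> triangles V. T \<inter> F \<noteq> {} \<and> \<not> T \<subseteq> F}"
  have fin: "finite (clusters V m)" "\<And>F. finite (?T F)"
    using finite_clusters[OF assms(1)] triangles_card(1)[OF assms(1)] by simp_all
  have "clusters V (Suc m) = (\<lambda>(F, T). F \<union> T) ` Sigma (clusters V m) ?T"
    by (auto simp: image_iff)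
  then have "(\<Sum>F\<in>clusters V (Suc m). q ^ card F)
      = (\<Sum>F\<in>(\<lambda>(F, T). F \<union> T) ` Sigma (clusters V m) ?T. q ^ card F)"
    by simp
  also have "\<dots> \<le> (\<Sum>x\<in>Sigma (clusters V m) ?T. q ^ card ((\<lambda>(F, T). F \<union> T) x))"
    using sum_image_le[of "Sigma (clusters V m) ?T" "\<lambda>F. q ^ card F" "\<lambda>(F, T). F \<union> T"] fin assms(2)
    by (simp add: o_def)
  also have "\<dots> = (\<Sum>F\<in>clusters V m. \<Sum>T\<in>?T F. q ^ card (F \<union> T))"
    using fin by (subst sum.Sigma) (auto intro: sum.cong)
  also have "\<dots> \<le> (\<Sum>F\<in>clusters V m. (2 * real m + 3)\<^sup>2 * ?\<rho> * q ^ card F)"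
  proof (rule sum_mono)
    fix F assume F: "F \<in> clusters V m"
    have "(\<Sum>T\<in>?T F. q ^ card (F \<union> T)) = (\<Sum>T\<in>?T F. q ^ card F * q ^ card (T - F))"
    proof (rule sum.cong)
      fix T assume "T \<in> ?T F"
      then have "finite T" using triangle_props(2)[of T V] by simp
      then have "card (F \<union> T) = card F + card (T - F)"
        using cluster_props[OF F] card_Un_disjoint[of F "T - F"] by auto
      then show "q ^ card (F \<union> T) = q ^ card F * q ^ card (T - F)" by (simp add: power_add)
    qed simp
    also have "\<dots> = q ^ card F * (\<Sum>T\<in>?T F. q ^ card (T - F))" by (simp add: sum_distrib_left)
    also have "\<dots> \<le> q ^ card F * ((real (card F))\<^sup>2 * ?\<rho>)"
      using triangles_meeting_weight[of V F q] cluster_props[OF F] assms by (intro mult_left_mono) auto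
    also have "\<dots> \<le> q ^ card F * ((2 * real m + 3)\<^sup>2 * ?\<rho>)"
      using cluster_props[OF F] assms by (intro mult_left_mono mult_right_mono power_mono) auto
    finally show "(\<Sum>T\<in>?T F. q ^ card (F \<union> T)) \<le> (2 * real m + 3)\<^sup>2 * ?\<rho> * q ^ card F"
      by (simp add: mult_ac)
  qed
  also have "\<dots> = (2 * real m + 3)\<^sup>2 * ?\<rho> * (\<Sum>F\<in>clusters V m. q ^ card F)"
    by (simp add: sum_distrib_left)
  also have "\<dots> \<le> (2 * real m + 3)\<^sup>2 * ?\<rho> *
      (real (card V) ^ 3 * ((\<Prod>i<m. (2 * real i + 3)\<^sup>2) * ?\<rho> ^ m))"
    using assms by (intro mult_left_mono Suc.IH) auto
  finally show ?case by (simp add: mult_ac)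
qed

text \<open>\<open>\<pi>\<close> sends an edge to its component under sharing a triangle of
  \<open>X\<close>. A cluster grown around \<open>e\<close> inside \<open>X\<close> gets stuck at
  some index \<open>j < m\<close>; stuck means closed under the triangles of \<open>X\<close> that
  meet it, so it contains the whole component of \<open>e\<close>.\<close>

lemma small_components:
  assumes "\<And>F. F \<in> clusters V m \<Longrightarrow> \<not> F \<subseteq> X"
  obtains \<pi> :: "'v set \<Rightarrow> 'v set set" where
    "\<forall>T \<in> triangles V. T \<subseteq> X \<longrightarrow> (\<forall>e\<in>T. \<forall>f\<in>T. \<pi> e = \<pi> f)"
    "\<forall>c. card {y \<in> X. \<pi> y = c} \<le> 2 * m + 3"
proof -
  define R where "R = {(e, f). \<exists>T \<in> triangles V. T \<subseteq> X \<and> e \<in> T \<and> f \<in> T}"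
  define \<pi> where "\<pi> e = R\<^sup>* `` {e}" for e
  have "\<pi> f \<subseteq> \<pi> e" if "(e, f) \<in> R" for e f
    using that by (auto simp: \<pi>_def intro: converse_rtrancl_into_rtrancl)
  then have same: "\<pi> e = \<pi> f" if "T \<in> triangles V" "T \<subseteq> X" "e \<in> T" "f \<in> T" for T e f
    using that unfolding R_def by blast
  have small: "card {y \<in> X. \<pi> y = c} \<le> 2 * m + 3" for c
  proof (cases "{y \<in> X. \<pi> y = c} = {}")
    case True
    then show ?thesis by (simp only: card.empty)
  next
    case False
    then obtain e where e: "e \<in> X" "c = \<pi> e" by blast
    have sub: "{y \<in> X. \<pi> y = c} \<subseteq> \<pi> e" using e by (auto simp: \<pi>_def)
    show ?thesis
    proof (cases "\<exists>T \<in> triangles V. T \<subseteq> X \<and> e \<in> T")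
      case False
      then have "R `` {e} = {}" by (auto simp: R_def)
      then have "\<pi> e = {e}" unfolding \<pi>_def by (auto elim: converse_rtranclE)
      then have "card {y \<in> X. \<pi> y = c} \<le> card {e}" using sub by (intro card_mono) auto
      then show ?thesis by simp
    next
      case True
      let ?P = "\<lambda>j. \<exists>F \<in> clusters V j. F \<subseteq> X \<and> e \<in> F"
      have "?P 0" "\<not> ?P m" using True assms by auto
      then obtain j where j: "j < m" "?P j" "\<not> ?P (Suc j)"
        using inc_induct[of 0 m "\<lambda>j. \<not> ?P j"] by blast
      then obtain F where F: "F \<in> clusters V j" "F \<subseteq> X" "e \<in> F" by blast
      have closed: "T \<subseteq> F" if "T \<in> triangles V" "T \<subseteq> X" "T \<inter> F \<noteq> {}" for T
      proof (rule ccontr)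
        assume "\<not> T \<subseteq> F"
        then have "F \<union> T \<in> clusters V (Suc j)" using that F(1) by auto
        moreover have "F \<union> T \<subseteq> X \<and> e \<in> F \<union> T" using F that by simp
        ultimately have "?P (Suc j)" by (rule bexI[rotated])
        with j(3) show False by (rule notE)
      qed
      have "f \<in> F" if "(e, f) \<in> R\<^sup>*" for f
        using that
      proof induction
        case base
        then show ?case by (rule F(3))
      next
        case (step f g)
        then obtain T where "T \<in> triangles V" "T \<subseteq> X" "f \<in> T" "g \<in> T" unfolding R_def by blast
        then show ?case using closed[of T] step.IH by blast
      qed
      then have "\<pi> e \<subseteq> F" by (auto simp: \<pi>_def)
      then have "card {y \<in> X. \<pi> y = c} \<le> card F"
        using sub cluster_props[OF F(1)] by (intro card_mono) auto
      then show ?thesis using cluster_props[OF F(1)] j(1) by simp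
    qed
  qed
  show thesis
  proof (rule that[of \<pi>])
    show "\<forall>T \<in> triangles V. T \<subseteq> X \<longrightarrow> (\<forall>e\<in>T. \<forall>f\<in>T. \<pi> e = \<pi> f)"
      by (intro ballI impI) (rule same)
    show "\<forall>c. card {y \<in> X. \<pi> y = c} \<le> 2 * m + 3" by (rule allI) (rule small)
  qed
qed

section \<open>Breaker's win for explicit parameters\<close>

lemma pancyclic_triangle:
  assumes "pancyclic V E" "3 \<le> card V"
  obtains T where "T \<in> triangles V" "T \<subseteq> E"
proof -
  obtain vs where vs: "is_cycle V E vs" "length vs = 3"
    using assms unfolding pancyclic_def by blast
  then obtain u v w where uvw: "vs = [u, v, w]"
    by (auto simp: numeral_3_eq_3 length_Suc_conv)
  have "{vs ! i, vs ! (Suc i mod 3)} \<in> E" if "i < 3" for i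
    using vs that by (simp add: is_cycle_def)
  from this[of 0] this[of 1] this[of 2] have "{u, v} \<in> E" "{v, w} \<in> E" "{u, w} \<in> E"
    by (auto simp: uvw insert_commute numeral_2_eq_2)
  moreover have "distinct [u, v, w]" "u \<in> V" "v \<in> V" "w \<in> V"
    using vs by (auto simp: is_cycle_def uvw)
  ultimately show thesis
    by (intro that[of "{{u, v}, {v, w}, {u, w}}"]) (auto simp: triangles_def)
qed

lemma finite_complete_edges: "finite V \<Longrightarrow> finite (complete_edges V)"
  by (simp add: complete_edges_def)

text \<open>After \<open>s\<close> stages the classes have at most
  \<open>2 * m + 3 \<le> 2 ^ t + 1\<close> edges. Pairing leaves two edges per class, while a
  surviving triangle would lie within one class and have three.\<close>

lemma breaker_wins:
  fixes n b m s t :: nat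
  assumes "3 \<le> n" "b \<ge> 1"
    and small: "(1 + real b) ^ s * (\<Sum>F\<in>clusters {..<n} m. (1 / (1 + real b) ^ s) ^ card F) < 1"
    and t: "2 * m + 2 \<le> 2 ^ t"
  shows "\<not> maker_ensures (complete_edges {..<n}) (PAN n) b (s + t)"
proof
  let ?X = "complete_edges {..<n}"
  assume "maker_ensures ?X (PAN n) b (s + t)"
  then obtain \<sigma> where \<sigma>: "maker_strategy b ?X \<sigma>" and win:
    "\<And>hs. legal_history b ?X hs \<Longrightarrow> length hs = s + t \<Longrightarrow> follows \<sigma> hs \<Longrightarrow> current_family (PAN n) hs \<noteq> {}"
    unfolding maker_ensures_def by blast
  have finX: "finite ?X" by (simp add: finite_complete_edges)
  have "(\<Sum>F\<in>clusters {..<n} m. 1 / (1 + real b) ^ (s * card F))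
      = (\<Sum>F\<in>clusters {..<n} m. (1 / (1 + real b) ^ s) ^ card F)"
    by (simp add: power_mult power_divide)
  with small have sm: "(1 + real b) ^ s * (\<Sum>F\<in>clusters {..<n} m. 1 / (1 + real b) ^ (s * card F)) < 1"
    by simp
  obtain hs where hs: "legal_history b ?X hs" "follows \<sigma> hs" "length hs = s"
    "\<And>F. F \<in> clusters {..<n} m \<Longrightarrow> \<not> F \<subseteq> current_board ?X hs"
    using breaker_potential[OF finX \<sigma> finite_clusters[of "{..<n}" m] _ sm] cluster_props
    by (metis finite_lessThan)
  obtain \<pi> :: "nat set \<Rightarrow> nat set set" where \<pi>:
    "\<forall>T \<in> triangles {..<n}. T \<subseteq> current_board ?X hs \<longrightarrow> (\<forall>e\<in>T. \<forall>f\<in>T. \<pi> e = \<pi> f)"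
    "\<forall>c. card {y \<in> current_board ?X hs. \<pi> y = c} \<le> 2 * m + 3"
    by (rule small_components[OF hs(4)])
  have "card {y \<in> current_board ?X hs. \<pi> y = c} \<le> 2 ^ t + 1" for c
    using spec[OF \<pi>(2), of c] t by linarith
  then obtain hs' where hs': "legal_history b ?X hs'" "follows \<sigma> hs'" "length hs' = length hs + t"
    "current_board ?X hs' \<subseteq> current_board ?X hs"
    "\<forall>c. card {y \<in> current_board ?X hs'. \<pi> y = c} \<le> 2"
    by (rule breaker_pairing[OF finX assms(2) \<sigma> hs(1,2)])
  obtain E where E: "E \<in> PAN n" "E \<subseteq> current_board ?X hs'"
    using win[OF hs'(1)] hs'(2,3) hs(3) current_family_eq[OF hs'(1), of "PAN n"] by (auto simp: PAN_def)
  obtain T where T: "T \<in> triangles {..<n}" "T \<subseteq> E"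
    using pancyclic_triangle[of "{..<n}" E] E(1) assms(1) by (auto simp: PAN_def)
  note Tp = triangle_props[OF T(1)]
  obtain e where e: "e \<in> T" using Tp(3) by fastforce
  have TX: "T \<subseteq> current_board ?X hs'" using T E by blast
  then have "T \<subseteq> {y \<in> current_board ?X hs'. \<pi> y = \<pi> e}" using \<pi>(1) T(1) e hs'(4) by blast
  then have "card T \<le> card {y \<in> current_board ?X hs'. \<pi> y = \<pi> e}"
    using finite_subset[OF legal_history_board[OF hs'(1)] finX] by (intro card_mono) auto
  then show False using spec[OF hs'(5), of "\<pi> e"] Tp(3) by simp
qed

section \<open>The threshold\<close>

definition star :: "'v set \<Rightarrow> 'v \<Rightarrow> 'v set set" where
  "star V v = {e \<in> complete_edges V. v \<in> e}"

definition edges_between :: "'v set \<Rightarrow> 'v set \<Rightarrow> 'v set set" where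
  "edges_between U W = (\<lambda>(u, w). {u, w}) ` (U \<times> W)"

lemma card_star:
  assumes "finite V" "v \<in> V"
  shows "card V - 1 \<le> card (star V v)"
proof -
  have "(\<lambda>w. {v, w}) ` (V - {v}) \<subseteq> star V v"
    using assms(2) by (auto simp: star_def complete_edges_def)
  moreover have "finite (star V v)" using assms(1) by (simp add: star_def finite_complete_edges)
  ultimately have "card ((\<lambda>w. {v, w}) ` (V - {v})) \<le> card (star V v)" by (intro card_mono)
  moreover have "inj_on (\<lambda>w. {v, w}) (V - {v})" by (auto simp: inj_on_def doubleton_eq_iff)
  ultimately show ?thesis using assms by (simp add: card_image)
qed

lemma card_star_Int_le_nbrs:
  assumes "finite V"
  shows "card (star V v \<inter> E) \<le> card (nbrs V E v)"
proof -
  have "star V v \<inter> E \<subseteq> (\<lambda>w. {v, w}) ` nbrs V E v"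
  proof
    fix e assume e: "e \<in> star V v \<inter> E"
    then obtain w where "e = {v, w}" "w \<in> V"
      by (auto simp: star_def complete_edges_def card_2_iff)
    then show "e \<in> (\<lambda>w. {v, w}) ` nbrs V E v" using e by (auto simp: nbrs_def)
  qed
  moreover have "finite (nbrs V E v)" using assms by (simp add: nbrs_def)
  ultimately show ?thesis by (meson card_image_le card_mono finite_imageI order_trans)
qed

lemma card_edges_between:
  assumes "U \<inter> W = {}"
  shows "card (edges_between U W) = card U * card W"
proof -
  have "inj_on (\<lambda>(u, w). {u, w}) (U \<times> W)"
    using assms by (auto simp: inj_on_def doubleton_eq_iff)
  then show ?thesis by (simp add: edges_between_def card_image card_cartesian_product)
qed

text \<open>Stars control the degrees, the other sets joinedness. Only the logarithm of their number
  matters, and it is at most \<open>3 * k * ln n\<close>.\<close>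

definition target_sets :: "'v set \<Rightarrow> nat \<Rightarrow> 'v set set set" where
  "target_sets V k = star V ` V \<union>
     {edges_between U W | U W. U \<subseteq> V \<and> W \<subseteq> V \<and> U \<inter> W = {} \<and> card U = k \<and> card W = k}"

lemma target_sets_subset: "A \<in> target_sets V k \<Longrightarrow> A \<subseteq> complete_edges V"
  by (force simp: target_sets_def star_def edges_between_def complete_edges_def card_insert_if)

lemma card_target_sets:
  assumes "finite V" "2 \<le> card V" "1 \<le> k" "k \<le> card V"
  shows "finite (target_sets V k)" "card (target_sets V k) \<le> card V ^ (3 * k)"
proof -
  let ?K = "{U. U \<subseteq> V \<and> card U = k}"
  let ?n = "card V"
  have sub: "target_sets V k \<subseteq> star V ` V \<union> (\<lambda>(U, W). edges_between U W) ` (?K \<times> ?K)"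
    by (auto simp: target_sets_def)
  have fin: "finite (star V ` V \<union> (\<lambda>(U, W). edges_between U W) ` (?K \<times> ?K))"
    using assms(1) by auto
  then show "finite (target_sets V k)" using sub finite_subset by blast
  have "card (target_sets V k) \<le> card (star V ` V) + card ((\<lambda>(U, W). edges_between U W) ` (?K \<times> ?K))"
    using card_mono[OF fin sub] card_Un_le order_trans by blast
  also have "card (star V ` V) \<le> ?n" using assms(1) by (rule card_image_le)
  also have "card ((\<lambda>(U, W). edges_between U W) ` (?K \<times> ?K)) \<le> card (?K \<times> ?K)"
    using assms(1) by (intro card_image_le) auto
  also have "card (?K \<times> ?K) = (?n choose k) * (?n choose k)"
    using assms(1) by (simp add: card_cartesian_product n_subsets)
  also have "\<dots> \<le> ?n ^ k * ?n ^ k" using binomial_le_pow[OF assms(4)] by (intro mult_mono) auto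
  also have "?n + ?n ^ k * ?n ^ k \<le> ?n ^ (2 * k) + ?n ^ (2 * k)"
    using assms(2,3) self_le_power[of ?n "2 * k"] by (simp add: mult_2 power_add)
  also have "\<dots> \<le> ?n * ?n ^ (2 * k)" using assms(2) by (simp flip: mult_2)
  also have "\<dots> = ?n ^ (2 * k + 1)" by simp
  also have "\<dots> \<le> ?n ^ (3 * k)" using assms by (intro power_increasing) auto
  finally show "card (target_sets V k) \<le> ?n ^ (3 * k)" by simp
qed

text \<open>\<open>stars\<close> and \<open>pairs\<close> are the size condition of
  \<open>maker_keeps_proportion\<close> for the two kinds of target sets, of size at least
  \<open>n - 1\<close> and exactly \<open>k ^ 2\<close>. Of the pairs Maker needs a single edge; of
  the stars she needs the degree demanded by \<open>joined_pancyclic\<close>, hence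
  \<open>deg\<close>.\<close>

lemma maker_wins:
  fixes n b k s :: nat and \<eta> :: real
  defines "r \<equiv> ((1 - 4 * \<eta>) / (real b + 1)) ^ s"
  assumes "3 \<le> n" "b \<ge> 1" "1 \<le> k" "k \<le> n" "0 < \<eta>" "\<eta> < 1 / 4"
    and stars: "real b * (3 * real k * ln (real n)) / \<eta>\<^sup>2 \<le> r * (real n - 1)"
    and pairs: "real b * (3 * real k * ln (real n)) / \<eta>\<^sup>2 \<le> r * (real k)\<^sup>2"
    and deg: "7 * real k + 3 \<le> r * (real n - 1)"
  shows "maker_ensures (complete_edges {..<n}) (PAN n) b s"
proof -
  let ?V = "{..<n}" and ?X = "complete_edges {..<n}"
  let ?A = "target_sets ?V k"
  have "0 < r" unfolding r_def using assms(7) by simp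
  have finX: "finite ?X" by (simp add: finite_complete_edges)
  have A: "finite ?A" "card ?A \<le> n ^ (3 * k)"
    using card_target_sets[of ?V k] assms(2,4,5) by auto
  have starA: "star ?V v \<in> ?A" "r * (real n - 1) \<le> r * card (star ?V v)" if "v < n" for v
    using that card_star[of ?V v] \<open>0 < r\<close> by (auto simp: target_sets_def)
  then have "card ?A \<noteq> 0" using A(1) assms(2) by (metis card_0_eq empty_iff less_le_trans zero_less_numeral)
  then have "ln (card ?A) \<le> ln (real (n ^ (3 * k)))"
    using A(2) assms(2) by (subst ln_le_cancel_iff) (auto simp del: of_nat_power)
  also have "\<dots> = 3 * real k * ln (real n)" using assms(2) by (simp add: ln_realpow)
  finally have lnA: "ln (card ?A) \<le> 3 * real k * ln (real n)" .
  have "real b * ln (card ?A) / \<eta>\<^sup>2 \<le> real b * (3 * real k * ln (real n)) / \<eta>\<^sup>2"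
    using lnA by (intro divide_right_mono mult_left_mono) auto
  moreover have "real b * (3 * real k * ln (real n)) / \<eta>\<^sup>2 \<le> r * card A" if "A \<in> ?A" for A
    using that unfolding target_sets_def
  proof
    assume "A \<in> star ?V ` ?V"
    then show ?thesis using stars starA(2) by fastforce
  next
    assume "A \<in> {edges_between U W | U W. U \<subseteq> ?V \<and> W \<subseteq> ?V \<and> U \<inter> W = {} \<and> card U = k \<and> card W = k}"
    then obtain U W where "A = edges_between U W" "U \<inter> W = {}" "card U = k" "card W = k" by blast
    then have "card A = k * k" using card_edges_between[of U W] by simp
    then show ?thesis using pairs by (simp add: power2_eq_square)
  qed
  ultimately have large: "real b * ln (card ?A) / \<eta>\<^sup>2 \<le> ((1 - 4 * \<eta>) / (real b + 1)) ^ s * card A"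
    if "A \<in> ?A" for A
    using that unfolding r_def by (meson order_trans)
  have "\<eta> \<le> 1 / 4" using assms(7) by simp
  obtain \<sigma> where \<sigma>: "maker_strategy b ?X \<sigma>" and
    "\<And>hs A. legal_history b ?X hs \<Longrightarrow> length hs = s \<Longrightarrow> follows \<sigma> hs \<Longrightarrow> A \<in> ?A \<Longrightarrow>
      ((1 - 4 * \<eta>) / (real b + 1)) ^ s * card A \<le> card (A \<inter> current_board ?X hs)"
    by (rule maker_keeps_proportion[OF finX A(1) target_sets_subset assms(3,6) \<open>\<eta> \<le> 1 / 4\<close> large]) blast+
  then have keep: "r * card A \<le> card (A \<inter> current_board ?X hs)"
    if "legal_history b ?X hs" "length hs = s" "follows \<sigma> hs" "A \<in> ?A" for hs A
    using that unfolding r_def by blast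
  have "current_family (PAN n) hs \<noteq> {}"
    if hs: "legal_history b ?X hs" "length hs = s" "follows \<sigma> hs" for hs
  proof -
    let ?G = "current_board ?X hs"
    have sub: "?G \<subseteq> ?X" using legal_history_board[OF hs(1)] .
    have "joined k ?V ?G"
      unfolding joined_def
    proof (intro allI impI)
      fix U W assume UW: "U \<subseteq> ?V \<and> W \<subseteq> ?V \<and> U \<inter> W = {} \<and> card U = k \<and> card W = k"
      then have "edges_between U W \<in> ?A" by (auto simp: target_sets_def)
      from keep[OF hs this] have "r * card (edges_between U W) \<le> card (edges_between U W \<inter> ?G)" .
      moreover have "0 < r * card (edges_between U W)"
        using UW card_edges_between[of U W] \<open>0 < r\<close> assms(4) by simp
      ultimately have "0 < card (edges_between U W \<inter> ?G)" by linarith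
      then have "edges_between U W \<inter> ?G \<noteq> {}" by (auto simp: card_gt_0_iff)
      then show "\<exists>u\<in>U. \<exists>w\<in>W. {u, w} \<in> ?G" by (auto simp: edges_between_def)
    qed
    moreover have "7 * k + 3 \<le> card (nbrs ?V ?G v)" if "v \<in> ?V" for v
    proof -
      have "7 * real k + 3 \<le> r * card (star ?V v)" using deg starA(2)[of v] that by simp
      also have "\<dots> \<le> card (star ?V v \<inter> ?G)" using keep[OF hs starA(1)] that by simp
      also have "\<dots> \<le> card (nbrs ?V ?G v)" using card_star_Int_le_nbrs[of ?V v ?G] by simp
      finally show ?thesis by linarith
    qed
    moreover have "{v} \<notin> ?G" for v using sub by (auto simp: complete_edges_def)
    ultimately have "pancyclic ?V ?G" using assms(4) by (intro joined_pancyclic[of ?V k]) auto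
    then have "?G \<in> PAN n" using sub by (simp add: PAN_def)
    then show ?thesis
      using current_family_eq[OF hs(1), of "PAN n"] by (auto simp: PAN_def)
  qed
  then show ?thesis using \<sigma> unfolding maker_ensures_def by blast
qed

section \<open>Asymptotics\<close>

lemma subpolynomial_le:
  assumes "subpolynomial (\<lambda>n. real (b n))" "0 < \<epsilon>"
  shows "\<forall>\<^sub>F n in sequentially. real (b n) + 1 \<le> real n powr \<epsilon>"
proof -
  have "(\<lambda>n. real (b n)) \<in> o(\<lambda>n. real n powr \<epsilon>)"
    using assms by (auto simp: subpolynomial_def)
  then have "\<forall>\<^sub>F n in sequentially. norm (real (b n)) \<le> 1 / 2 * norm (real n powr \<epsilon>)"
    by (rule landau_o.smallD) simp
  moreover have "\<forall>\<^sub>F n in sequentially. 1 \<le> 1 / 2 * real n powr \<epsilon>"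
    using assms(2) by real_asymp
  ultimately show ?thesis by eventually_elim auto
qed

lemma log_subpolynomial_ge:
  assumes "\<And>n. b n \<ge> 1" "subpolynomial (\<lambda>n. real (b n))"
  shows "\<forall>\<^sub>F n in sequentially. K \<le> log (real (b n) + 1) (real n)"
proof -
  \<comment> \<open>The maximum keeps the exponent positive for every real \<open>K\<close>.\<close>
  have "0 < 1 / max K 1" by simp
  from subpolynomial_le[OF assms(2) this] eventually_ge_at_top[of 2]
  show ?thesis
  proof eventually_elim
    case (elim n)
    have "ln (real (b n) + 1) \<le> ln (real n powr (1 / max K 1))"
      using elim by (subst ln_le_cancel_iff) auto
    also have "\<dots> = ln (real n) / max K 1" using elim by (simp add: ln_powr)
    finally have "max K 1 * ln (real (b n) + 1) \<le> ln (real n)" by (simp add: field_simps)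
    moreover have "0 < ln (real (b n) + 1)" using assms(1)[of n] by (intro ln_gt_zero) auto
    ultimately have "max K 1 \<le> log (real (b n) + 1) (real n)"
      unfolding log_def by (subst pos_le_divide_eq)
    then show ?case by simp
  qed
qed

text \<open>Half of the surplus \<open>\<epsilon>\<close> brings the density below
  \<open>n powr (- 1 / 2)\<close>; the other half leaves enough stages for pairing. Treating all
  large \<open>s'\<close> at once bounds the values that Maker can ensure without a monotonicity
  argument.\<close>

lemma breaker_asymptotic:
  assumes b: "\<And>n. b n \<ge> 1" "subpolynomial (\<lambda>n. real (b n))" and \<epsilon>: "0 < \<epsilon>" "\<epsilon> \<le> 1 / 2"
  shows "\<forall>\<^sub>F n in sequentially. \<forall>s'. (1 / 2 + \<epsilon>) * log (real (b n) + 1) (real n) \<le> real s' \<longrightarrow>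
    \<not> maker_ensures (complete_edges {..<n}) (PAN n) (b n) s'"
proof -
  \<comment> \<open>The attached triangles contribute
    \<open>(2 * n powr (- \<epsilon>)) ^ m \<le> 2 ^ m * n powr (- 6)\<close>. This pays for the
    \<open>n ^ 3\<close> of the initial triangles, for the loss
    \<open>(b + 1) ^ s \<le> n ^ 2\<close> and, with one factor \<open>n\<close> to spare, for
    \<open>C\<close>.\<close>
  define m where "m = nat \<lceil>6 / \<epsilon>\<rceil>"
  have "6 / \<epsilon> \<le> real m" unfolding m_def by linarith
  then have m: "6 \<le> \<epsilon> * m" using \<epsilon> by (simp add: field_simps)
  define C where "C = (\<Prod>i<m. (2 * real i + 3)\<^sup>2) * 2 ^ m"
  have "0 \<le> C" unfolding C_def by (intro mult_nonneg_nonneg prod_nonneg) auto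
  have "\<forall>\<^sub>F n in sequentially. C < real n" by real_asymp
  moreover have "\<forall>\<^sub>F n in sequentially. real (b n) + 1 \<le> real n powr (1 / 2)"
    using subpolynomial_le[OF b(2), of "1 / 2"] by simp
  ultimately show ?thesis
    using log_subpolynomial_ge[OF b, of "(2 * real m + 3) * 2 / \<epsilon>"]
    eventually_ge_at_top[of 3]
  proof eventually_elim
    case (elim n)
    define B where "B = real (b n) + 1"
    define L where "L = log B (real n)"
    have B: "1 < B" using b(1)[of n] by (simp add: B_def)
    have n: "1 < real n" using elim by simp
    have bL: "B powr L = real n" using B n by (simp add: L_def)
    have L: "(2 * real m + 3) * 2 / \<epsilon> \<le> L" using elim by (simp add: L_def B_def)
    then have L': "2 * real m + 3 \<le> \<epsilon> / 2 * L" using \<epsilon> by (simp add: field_simps)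
    then have "0 < \<epsilon> / 2 * L" by linarith
    then have "0 < L" using \<epsilon> by (simp add: zero_less_mult_iff)
    define s where "s = nat \<lceil>(1 / 2 + \<epsilon> / 2) * L\<rceil>"
    have "0 \<le> (1 / 2 + \<epsilon> / 2) * L" using \<epsilon> \<open>0 < L\<close> by simp
    then have s: "(1 / 2 + \<epsilon> / 2) * L \<le> real s" "real s \<le> (1 / 2 + \<epsilon> / 2) * L + 1"
      unfolding s_def by linarith+
    have pw: "B powr (c * L) = real n powr c" for c
      using bL by (metis mult.commute powr_powr)
    have lo: "real n powr (1 / 2 + \<epsilon> / 2) \<le> B ^ s"
      using powr_mono[OF s(1), of B] B by (simp add: pw powr_realpow)
    \<comment> \<open>Rounding \<open>s\<close> up costs one extra factor \<open>B\<close>, which is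
      at most \<open>n powr (1 / 2)\<close>.\<close>
    have "B ^ s \<le> B powr ((1 / 2 + \<epsilon> / 2) * L + 1)"
      using powr_mono[OF s(2), of B] B by (simp add: powr_realpow)
    also have "\<dots> = real n powr (1 / 2 + \<epsilon> / 2) * B" using B by (simp add: powr_add pw)
    also have "\<dots> \<le> real n powr 1 * real n powr (1 / 2)"
      using elim \<epsilon> n B by (intro mult_mono powr_mono) (auto simp: B_def)
    also have "\<dots> \<le> real n powr 2"
      unfolding powr_add[symmetric] using n by (intro powr_mono) auto
    finally have hi: "B ^ s \<le> real n ^ 2" using n by (simp add: powr_numeral)
    define q where "q = 1 / B ^ s"
    have q: "0 \<le> q" "q \<le> 1" using B by (auto simp: q_def one_le_power)
    have "q \<le> 1 / real n powr (1 / 2 + \<epsilon> / 2)"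
      unfolding q_def using lo n B by (intro divide_left_mono) auto
    then have qn: "q \<le> real n powr (- (1 / 2 + \<epsilon> / 2))" by (simp only: powr_minus_divide)
    have "real n * q\<^sup>2 \<le> real n powr 1 * (real n powr (- (1 / 2 + \<epsilon> / 2)))\<^sup>2"
      using qn q n by (intro mult_mono power_mono) auto
    also have "\<dots> = real n powr (- \<epsilon>)"
      unfolding power2_eq_square powr_add[symmetric] by simp
    finally have "real n * q\<^sup>2 \<le> real n powr (- \<epsilon>)" .
    moreover have "q \<le> real n powr (- \<epsilon>)"
      using qn \<epsilon> n by (intro order.trans[OF qn] powr_mono) auto
    ultimately have \<rho>: "real n * q\<^sup>2 + q \<le> 2 * real n powr (- \<epsilon>)" by simp
    have "(real n * q\<^sup>2 + q) ^ m \<le> (2 * real n powr (- \<epsilon>)) ^ m"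
      using \<rho> q by (intro power_mono) auto
    also have "\<dots> = 2 ^ m * real n powr (- (\<epsilon> * m))"
      using n by (simp add: power_mult_distrib powr_realpow[symmetric] powr_powr)
    also have "\<dots> \<le> 2 ^ m * real n powr (- 6)"
      using m n by (intro mult_left_mono powr_mono) auto
    finally have \<rho>m: "(real n * q\<^sup>2 + q) ^ m \<le> 2 ^ m * real n powr (- 6)" .
    have "(\<Sum>F\<in>clusters {..<n} m. q ^ card F)
        \<le> real n ^ 3 * ((\<Prod>i<m. (2 * real i + 3)\<^sup>2) * (real n * q\<^sup>2 + q) ^ m)"
      using clusters_weight[of "{..<n}" q m] q by simp
    also have "\<dots> \<le> real n ^ 3 * ((\<Prod>i<m. (2 * real i + 3)\<^sup>2) * (2 ^ m * real n powr (- 6)))"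
      by (intro mult_left_mono \<rho>m prod_nonneg) auto
    also have "\<dots> = C * real n ^ 3 * real n powr (- 6)" by (simp add: C_def)
    finally have "B ^ s * (\<Sum>F\<in>clusters {..<n} m. q ^ card F)
        \<le> real n ^ 2 * (C * real n ^ 3 * real n powr (- 6))"
      using hi B q by (intro mult_mono sum_nonneg) auto
    also have "\<dots> = C * (real n ^ 5 * real n powr (- 6))"
      by (simp add: power_numeral_reduce power2_eq_square)
    also have "real n ^ 5 * real n powr (- 6) = real n powr 5 * real n powr (- 6)"
      using n by (simp add: powr_numeral)
    also have "\<dots> = real n powr (- 1)" unfolding powr_add[symmetric] by simp
    also have "C * real n powr (- 1) < 1" using elim n by (simp add: powr_minus_divide)
    finally have small: "B ^ s * (\<Sum>F\<in>clusters {..<n} m. q ^ card F) < 1" .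
    show ?case
    proof (intro allI impI)
      fix s' assume s': "(1 / 2 + \<epsilon>) * log (real (b n) + 1) (real n) \<le> real s'"
      then have "(1 / 2 + \<epsilon> / 2) * L + \<epsilon> / 2 * L \<le> real s'" by (simp add: L_def B_def algebra_simps)
      then have "real s + (2 * real m + 2) \<le> real s'" using s(2) L' by linarith
      then have le: "s + (2 * m + 2) \<le> s'" by linarith
      \<comment> \<open>All remaining stages are used for pairing; the crude
        \<open>t < 2 ^ t\<close> is enough, as their number grows with \<open>n\<close>.\<close>
      have "2 * m + 2 \<le> s' - s" using le by simp
      also have "\<dots> \<le> 2 ^ (s' - s)" by (rule less_imp_le[OF less_exp])
      finally have "\<not> maker_ensures (complete_edges {..<n}) (PAN n) (b n) (s + (s' - s))"
        using small elim b(1)[of n] by (intro breaker_wins[where m = m]) (auto simp: B_def q_def add.commute)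
      then show "\<not> maker_ensures (complete_edges {..<n}) (PAN n) (b n) s'" using le by simp
    qed
  qed
qed

text \<open>The density kept is \<open>r \<ge> n powr (- 1 / 2 + \<epsilon> / 2)\<close>. With
  \<open>k\<close> about \<open>n powr (1 / 2 - \<epsilon> / 8)\<close>, the product
  \<open>r * k\<close> is at least \<open>n powr (3 * \<epsilon> / 8)\<close> and beats
  \<open>b * ln n\<close>, where \<open>b \<le> n powr (\<epsilon> / 16)\<close>; the degrees, of
  order \<open>r * n\<close>, exceed any multiple of \<open>k\<close>.\<close>

lemma maker_asymptotic:
  assumes b: "\<And>n. b n \<ge> 1" "subpolynomial (\<lambda>n. real (b n))" and \<epsilon>: "0 < \<epsilon>" "\<epsilon> \<le> 1 / 2"
  shows "\<forall>\<^sub>F n in sequentially. \<forall>s. real s \<le> (1 / 2 - \<epsilon>) * log (real (b n) + 1) (real n) \<longrightarrow>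
    maker_ensures (complete_edges {..<n}) (PAN n) (b n) s"
proof -
  \<comment> \<open>A constant that makes the accumulated loss harmless: \<open>(1 - 4 * \<eta>) ^ s
    = (2 ^ s) powr (- \<epsilon> / 2) \<ge> n powr (- \<epsilon> / 2)\<close>, because
    \<open>2 ^ s \<le> (b + 1) ^ s \<le> n\<close>.\<close>
  define \<eta> :: real where "\<eta> = (1 - 2 powr (- \<epsilon> / 2)) / 4"
  have "2 powr (- \<epsilon> / 2) < 2 powr (0 :: real)" using \<epsilon> by (intro powr_less_mono) auto
  then have \<eta>: "0 < \<eta>" "\<eta> < 1 / 4" "1 - 4 * \<eta> = 2 powr (- \<epsilon> / 2)"
    by (auto simp: \<eta>_def field_simps)
  have "\<forall>\<^sub>F n in sequentially. 3 * real n powr (\<epsilon> / 16) * ln (real n) / \<eta>\<^sup>2 \<le> real n powr (3 * \<epsilon> / 8)"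
  proof -
    have "((\<lambda>n. real n powr (\<epsilon> / 16) * ln (real n) / real n powr (3 * \<epsilon> / 8)) \<longlongrightarrow> 0) sequentially"
      using \<epsilon> by real_asymp
    moreover have "0 < \<eta>\<^sup>2 / 3" using \<eta> by simp
    ultimately have "\<forall>\<^sub>F n in sequentially.
        real n powr (\<epsilon> / 16) * ln (real n) / real n powr (3 * \<epsilon> / 8) < \<eta>\<^sup>2 / 3"
      by (rule order_tendstoD)
    with eventually_gt_at_top[of 0] show ?thesis
      by eventually_elim (use \<eta> in \<open>simp add: field_simps\<close>)
  qed
  moreover have "\<forall>\<^sub>F n in sequentially. (2 * real n powr (1 / 2 - \<epsilon> / 8))\<^sup>2 \<le> real n - 1"
    using \<epsilon> by real_asymp
  moreover have "\<forall>\<^sub>F n in sequentially. 20 * real n powr (1 / 2 - \<epsilon> / 8) \<le> real n powr (- (1 / 2) + \<epsilon> / 2) * (real n - 1)"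
    using \<epsilon> by real_asymp
  moreover have "\<forall>\<^sub>F n in sequentially. real (b n) + 1 \<le> real n powr (\<epsilon> / 16)"
    using subpolynomial_le[OF b(2), of "\<epsilon> / 16"] \<epsilon> by simp
  ultimately show ?thesis using eventually_ge_at_top[of 3]
  proof eventually_elim
    case (elim n)
    define B where "B = real (b n) + 1"
    define L where "L = log B (real n)"
    define y where "y = real n powr (1 / 2 - \<epsilon> / 8)"
    define k where "k = nat \<lceil>y\<rceil>"
    have B: "2 \<le> B" using b(1)[of n] by (simp add: B_def)
    have n: "1 < real n" "3 \<le> n" using elim by simp_all
    have "1 \<le> y" unfolding y_def using n \<epsilon> by (intro ge_one_powr_ge_zero) auto
    then have k: "y \<le> real k" "real k \<le> 2 * y" "1 \<le> k" unfolding k_def by linarith+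
    \<comment> \<open>Stars are thus at least as large as the sets of pairs, and their size
      condition follows from that for the pairs.\<close>
    have kn: "(real k)\<^sup>2 \<le> real n - 1"
      using elim(2) k(2) power_mono[of "real k" "2 * y" 2] by (simp add: y_def)
    have "real k \<le> (real k)\<^sup>2" using k(3) by (intro self_le_power) auto
    then have "k \<le> n" using kn by linarith
    show ?case
    proof (intro allI impI)
      fix s assume "real s \<le> (1 / 2 - \<epsilon>) * log (real (b n) + 1) (real n)"
      then have s: "real s \<le> (1 / 2 - \<epsilon>) * L" by (simp add: L_def B_def)
      define r where "r = ((1 - 4 * \<eta>) / B) ^ s"
      have "0 \<le> r" using \<eta> B by (simp add: r_def)
      have "B ^ s \<le> B powr ((1 / 2 - \<epsilon>) * L)"
        using powr_mono[OF s, of B] B by (simp add: powr_realpow)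
      also have "\<dots> = (B powr L) powr (1 / 2 - \<epsilon>)" by (simp add: powr_powr mult.commute)
      also have "B powr L = real n" using B n by (simp add: L_def)
      finally have Bs: "B ^ s \<le> real n powr (1 / 2 - \<epsilon>)" .
      have "2 ^ s \<le> B ^ s" using B by (intro power_mono) auto
      also have "\<dots> \<le> real n powr 1"
        using n \<epsilon> by (intro order.trans[OF Bs] powr_mono) auto
      finally have "2 powr real s \<le> real n" using n by (simp add: powr_realpow)
      then have "real n powr (- \<epsilon> / 2) \<le> (2 powr real s) powr (- \<epsilon> / 2)"
        using \<epsilon> by (intro powr_mono2') auto
      also have "\<dots> = (2 powr (- \<epsilon> / 2)) ^ s"
        by (simp add: powr_realpow[symmetric] powr_powr mult.commute)
      finally have num: "real n powr (- \<epsilon> / 2) \<le> (1 - 4 * \<eta>) ^ s" using \<eta>(3) by simp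
      have "real n powr (- (1 / 2) + \<epsilon> / 2) = real n powr (- \<epsilon> / 2) / real n powr (1 / 2 - \<epsilon>)"
        by (simp add: powr_diff[symmetric])
      also have "\<dots> \<le> (1 - 4 * \<eta>) ^ s / B ^ s"
        using num Bs B n \<eta> by (intro frac_le) auto
      finally have r: "real n powr (- (1 / 2) + \<epsilon> / 2) \<le> r" by (simp add: r_def power_divide)
      have "3 * real (b n) * ln (real n) / \<eta>\<^sup>2 \<le> 3 * real n powr (\<epsilon> / 16) * ln (real n) / \<eta>\<^sup>2"
        using elim n by (intro divide_right_mono mult_right_mono) auto
      also have "\<dots> \<le> real n powr (3 * \<epsilon> / 8)" by (rule elim(1))
      also have "\<dots> = real n powr (- (1 / 2) + \<epsilon> / 2) * y"
        by (simp add: y_def powr_add[symmetric])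
      also have "\<dots> \<le> r * real k"
        using r k \<open>1 \<le> y\<close> \<open>0 \<le> r\<close> by (intro mult_mono) auto
      finally have "real k * (3 * real (b n) * ln (real n) / \<eta>\<^sup>2) \<le> real k * (r * real k)"
        by (intro mult_left_mono) auto
      then have pairs: "real (b n) * (3 * real k * ln (real n)) / \<eta>\<^sup>2 \<le> r * (real k)\<^sup>2"
        by (simp add: power2_eq_square mult_ac)
      moreover have "real (b n) * (3 * real k * ln (real n)) / \<eta>\<^sup>2 \<le> r * (real n - 1)"
        using kn \<open>0 \<le> r\<close> by (intro order.trans[OF pairs] mult_left_mono) auto
      moreover have "7 * real k + 3 \<le> 20 * y" using k by linarith
      then have "7 * real k + 3 \<le> r * (real n - 1)"
        using order.trans[OF elim(3) mult_right_mono[OF r, of "real n - 1"]] n by (simp add: y_def)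
      ultimately show "maker_ensures (complete_edges {..<n}) (PAN n) (b n) s"
        using b(1)[of n] n(2) k(3) \<open>k \<le> n\<close> \<eta>(1,2)
        unfolding r_def B_def by (intro maker_wins[where k = k and \<eta> = \<eta>]) auto
    qed
  qed
qed

lemma threshold_asymptotic:
  assumes b: "\<And>n. b n \<ge> 1" "subpolynomial (\<lambda>n. real (b n))" and "0 < \<epsilon>"
  shows "\<forall>\<^sub>F n in sequentially.
    \<bar>real (threshold (complete_edges {..<n}) (PAN n) (b n)) / log (real (b n) + 1) (real n) - 1 / 2\<bar> \<le> \<epsilon>"
proof -
  \<comment> \<open>One \<open>\<epsilon>'\<close> is the margin in the game, the other absorbs the
    rounding of \<open>s\<close>; the cap fits the two bounds above.\<close>
  define \<epsilon>' where "\<epsilon>' = min (\<epsilon> / 2) (1 / 2)"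
  have \<epsilon>': "0 < \<epsilon>'" "\<epsilon>' \<le> 1 / 2" "2 * \<epsilon>' \<le> \<epsilon>" using assms(3) by (auto simp: \<epsilon>'_def)
  show ?thesis
    using breaker_asymptotic[OF b \<epsilon>'(1,2)] maker_asymptotic[OF b \<epsilon>'(1,2)]
      log_subpolynomial_ge[OF b, of "1 / \<epsilon>'"]
  proof eventually_elim
    case (elim n)
    define L where "L = log (real (b n) + 1) (real n)"
    let ?P = "maker_ensures (complete_edges {..<n}) (PAN n) (b n)"
    define \<tau> where "\<tau> = threshold (complete_edges {..<n}) (PAN n) (b n)"
    have L: "1 / \<epsilon>' \<le> L" using elim by (simp add: L_def)
    then have "0 < L" using \<epsilon>'(1) by (smt (verit) zero_less_divide_1_iff)
    have L1: "1 \<le> \<epsilon>' * L" using L \<epsilon>'(1) by (simp add: field_simps)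
    have up: "real s < (1 / 2 + \<epsilon>') * L" if "?P s" for s
      using elim(1) that unfolding L_def by (meson not_le)
    \<comment> \<open>Together with \<open>?P s\<close> below, this makes \<open>GREATEST\<close>
      meaningful.\<close>
    have bound: "\<forall>s. ?P s \<longrightarrow> s \<le> nat \<lceil>(1 / 2 + \<epsilon>') * L\<rceil>"
    proof (intro allI impI)
      fix s assume "?P s"
      then show "s \<le> nat \<lceil>(1 / 2 + \<epsilon>') * L\<rceil>" using up[of s] by linarith
    qed
    define s where "s = nat \<lfloor>(1 / 2 - \<epsilon>') * L\<rfloor>"
    have "0 \<le> (1 / 2 - \<epsilon>') * L" using \<epsilon>' \<open>0 < L\<close> by simp
    then have s: "real s \<le> (1 / 2 - \<epsilon>') * L" "(1 / 2 - \<epsilon>') * L - 1 \<le> real s"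
      unfolding s_def by linarith+
    have "?P s" using elim(2) s(1) unfolding L_def by blast
    have "?P \<tau>" unfolding \<tau>_def threshold_def
      by (rule GreatestI_nat[where P = ?P, OF \<open>?P s\<close>]) (use bound in blast)
    have "s \<le> \<tau>" unfolding \<tau>_def threshold_def
      by (rule Greatest_le_nat[where P = ?P, OF \<open>?P s\<close>]) (use bound in blast)
    have "real \<tau> \<le> 1 / 2 * L + \<epsilon>' * L" using up[OF \<open>?P \<tau>\<close>] by (simp add: algebra_simps)
    moreover have "1 / 2 * L - \<epsilon>' * L - \<epsilon>' * L \<le> real \<tau>"
      using s(2) L1 \<open>s \<le> \<tau>\<close> by (simp add: algebra_simps)
    moreover have "(2 * \<epsilon>') * L \<le> \<epsilon> * L" using \<epsilon>'(3) \<open>0 < L\<close> by (intro mult_right_mono) auto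
    then have "\<epsilon>' * L + \<epsilon>' * L \<le> \<epsilon> * L" by (simp add: algebra_simps)
    ultimately have "\<bar>real \<tau> - 1 / 2 * L\<bar> \<le> \<epsilon> * L" using L1 by linarith
    then have "\<bar>real \<tau> - 1 / 2 * L\<bar> / \<bar>L\<bar> \<le> \<epsilon>" using \<open>0 < L\<close> by (simp add: pos_divide_le_eq)
    also have "\<bar>real \<tau> - 1 / 2 * L\<bar> / \<bar>L\<bar> = \<bar>(real \<tau> - 1 / 2 * L) / L\<bar>"
      by (rule abs_divide[symmetric])
    also have "(real \<tau> - 1 / 2 * L) / L = real \<tau> / L - 1 / 2"
      using \<open>0 < L\<close> by (simp add: diff_divide_distrib)
    finally show ?case by (simp add: \<tau>_def L_def)
  qed
qed

theorem theorem1p5: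
  fixes b :: "nat \<Rightarrow> nat"
  assumes "\<And>n. b n \<ge> 1"
    and "subpolynomial (\<lambda>n. real (b n))"
  shows "\<exists>\<delta> :: nat \<Rightarrow> real. \<delta> \<in> o(\<lambda>_. 1) \<and>
    (\<forall>\<^sub>F n in sequentially.
       real (threshold (complete_edges {..<n}) (PAN n) (b n))
         = (1 / 2 + \<delta> n) * log (real (b n + 1)) (real n))"
proof -
  \<comment> \<open>For small \<open>n\<close> the logarithm may be 0 and the quotient meaningless;
    the equation is claimed only eventually, where the logarithm is at least 1.\<close>
  define \<delta> where "\<delta> n = real (threshold (complete_edges {..<n}) (PAN n) (b n))
    / log (real (b n) + 1) (real n) - 1 / 2" for n
  have "\<delta> \<in> o(\<lambda>_. 1)"
  proof (rule landau_o.smallI)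
    fix c :: real assume "0 < c"
    from threshold_asymptotic[OF assms this]
    show "\<forall>\<^sub>F n in sequentially. norm (\<delta> n) \<le> c * norm (1 :: real)" by (simp add: \<delta>_def)
  qed
  moreover have "\<forall>\<^sub>F n in sequentially.
       real (threshold (complete_edges {..<n}) (PAN n) (b n))
         = (1 / 2 + \<delta> n) * log (real (b n + 1)) (real n)"
    using log_subpolynomial_ge[OF assms, of 1]
    by eventually_elim (simp add: \<delta>_def add.commute)
  ultimately show ?thesis by blast
qed

end
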